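(* Let $n$ be a positive integer, $d := n-1$, $[n]:=\{1,\ldots,n\}$, and let $z_{(\cdot)}: 2^{[n]}\to\mathbb R$, $I\mapsto z_I$, be a submodular function with $z_\emptyset = z_{[n]} = 0$. Let $$P(\underline z) = \Big\{ x \in \mathbb R^n \ \Big|\ \sum_{i\in [n]} x_i = z_{[n]},\ \sum_{i\in I} x_i \leq z_I \ \ \forall I\subset [n]\Big\}$$ be the associated generalized permutohedron. Then $$(n-1)!\, \operatorname{Vol} P(\underline z) = \sum_{I_\bullet, \underline d} (-1)^{d-k} \binom{d}{d_1, \ldots, d_k}\prod_{i=1}^k \binom{d_i -1}{\widetilde d_i - |I_i|} \binom{|I_{i+1}| - |I_i| - 1}{\widetilde d_i - |I_i|}z_{I_i}^{d_i},$$ where the summation is over all chains $\emptyset \subsetneq I_1 \subsetneq \cdots \subsetneq I_k\subsetneq I_{k+1} = [n]$ of subsets of $[n]$ (of any length $k$) and all tuples $\underline d = (d_1, \ldots, d_k)$ of positive integers such that $\sum_{i=1}^k d_i = n-1$, and $\widetilde d_j:= \sum_{i=1}^j d_i$.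
   Context: A function $z:2^{[n]}\to\mathbb R$ is submodular if $z_I+z_J\ge z_{I\cup J}+z_{I\cap J}$ for all $I,J\subset[n]$. $\operatorname{Vol}$ denotes $(n-1)$-dimensional volume on the hyperplane $\{x\in\mathbb R^n : \sum_i x_i=0\}$, normalized so that a fundamental parallelepiped of the lattice $\{x\in\mathbb Z^n:\sum_i x_i=0\}$ has volume $1$. A binomial coefficient $\binom ab$ is zero if $b<0$ or $b>a$; $\binom{d}{d_1,\ldots,d_k}=d!/(d_1!\cdots d_k!)$. *)

theory Defs
  imports "HOL-Analysis.Analysis"
begin

text \<open>
  The index set $[n]$ is a type \<open>'n\<close>, with \<open>n = CARD('n)\<close>.  Its sort
  \<open>{finite, wellorder}\<close> is that of $\{1,\dots,n\}$ with the usual order; the order is needed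
  only because the library states \<open>measure_linear_image\<close> at this sort.
\<close>

section \<open>Normalised volume on the hyperplane of vectors with coordinate sum zero\<close>

definition zero_sum_lattice :: "(real ^ 'n::finite) set" where
  "zero_sum_lattice = {x. (\<forall>i. x $ i \<in> \<int>) \<and> (\<Sum>i\<in>UNIV. x $ i) = 0}"

definition lattice_basis :: "(real ^ 'n::finite) set \<Rightarrow> (real ^ 'n) set \<Rightarrow> bool" where
  "lattice_basis B L \<longleftrightarrow>
     independent B \<and> {(\<Sum>b\<in>B. of_int (c b) *\<^sub>R b) | c :: real ^ 'n \<Rightarrow> int. True} = L"

definition parallelepiped :: "(real ^ 'n::finite) set \<Rightarrow> (real ^ 'n) set" where
  "parallelepiped B =
     {(\<Sum>b\<in>B. t b *\<^sub>R b) | t :: real ^ 'n \<Rightarrow> real. \<forall>b\<in>B. 0 \<le> t b \<and> t b \<le> 1}"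

definition unit_normal :: "real ^ 'n::finite" where
  "unit_normal = (\<chi> i. 1 / sqrt (real CARD('n)))"

text \<open>
  Euclidean $(n-1)$-dimensional volume of a subset of the hyperplane: the Lebesgue measure in
  $\mathbb{R}^n$ of the right prism of height 1 over it.
\<close>

definition prism :: "(real ^ 'n::finite) set \<Rightarrow> (real ^ 'n) set" where
  "prism A = {x + s *\<^sub>R unit_normal | x s. x \<in> A \<and> 0 \<le> s \<and> s \<le> 1}"

definition euclidean_vol :: "(real ^ 'n::finite) set \<Rightarrow> real" where
  "euclidean_vol A = measure lebesgue (prism A)"

text \<open>
  The choice of a basis is immaterial: bases exist (\<open>lattice_basis_exists\<close>), all their
  parallelepipeds have the same nonzero Euclidean volume (\<open>euclidean_vol_parallelepiped\<close>),
  hence normalised volume 1 (\<open>Vol_parallelepiped\<close>).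
\<close>

definition Vol :: "(real ^ 'n::finite) set \<Rightarrow> real" where
  "Vol A = euclidean_vol A /
     euclidean_vol (parallelepiped (SOME B :: (real ^ 'n) set. lattice_basis B zero_sum_lattice))"

lemma lattice_basis_exists:
  "\<exists>B :: (real ^ 'n::finite) set. lattice_basis B zero_sum_lattice"
proof -
  fix j :: 'n
  define h where "h i = (axis i 1 - axis j 1 :: real ^ 'n)" for i
  define B where "B = h ` (UNIV - {j})"
  have h_nth: "h i $ k = (if k = i then 1 else 0) - (if k = j then 1 else 0)" for i k
    by (simp add: h_def axis_def)
  have inj: "inj_on h (UNIV - {j})"
  proof (rule inj_onI)
    fix i k assume "i \<in> UNIV - {j}" "k \<in> UNIV - {j}" "h i = h k"
    then have "h i $ i = h k $ i" by simp
    then show "i = k" using \<open>i \<in> UNIV - {j}\<close> by (simp add: h_nth split: if_splits)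
  qed
  have sum_nth: "(\<Sum>i\<in>UNIV - {j}. c i *\<^sub>R h i) $ k = (if k = j then - (\<Sum>i\<in>UNIV - {j}. c i) else c k)"
    for c :: "'n \<Rightarrow> real" and k
  proof (cases "k = j")
    case True
    then have "(\<Sum>i\<in>UNIV - {j}. c i *\<^sub>R h i) $ k = (\<Sum>i\<in>UNIV - {j}. - c i)"
      by (auto simp: h_nth intro!: sum.cong)
    then show ?thesis using True by (simp add: sum_negf)
  next
    case False
    then have "(\<Sum>i\<in>UNIV - {j}. c i *\<^sub>R h i) $ k = (\<Sum>i\<in>UNIV - {j}. if i = k then c i else 0)"
      unfolding sum_component by (intro sum.cong) (auto simp: h_nth)
    then show ?thesis using False by simp
  qed
  have sumB: "(\<Sum>b\<in>B. f b *\<^sub>R b) = (\<Sum>i\<in>UNIV - {j}. f (h i) *\<^sub>R h i)" for f :: "real ^ 'n \<Rightarrow> real"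
    unfolding B_def using inj by (simp add: sum.reindex)
  have finB: "finite B" by (simp add: B_def)
  have "independent B"
  proof (rule independent_if_scalars_zero[OF finB])
    fix f x assume 0: "(\<Sum>x\<in>B. f x *\<^sub>R x) = 0" and "x \<in> B"
    then obtain i where i: "i \<noteq> j" "x = h i" by (auto simp: B_def)
    have "(\<Sum>i\<in>UNIV - {j}. f (h i) *\<^sub>R h i) $ i = 0"
      using 0 sumB[of f] by simp
    then show "f x = 0" using i by (subst (asm) sum_nth) simp
  qed
  moreover have "{(\<Sum>b\<in>B. of_int (c b) *\<^sub>R b) | c :: real ^ 'n \<Rightarrow> int. True} = zero_sum_lattice"
  proof (intro equalityI subsetI)
    fix x assume "x \<in> {(\<Sum>b\<in>B. of_int (c b) *\<^sub>R b) | c :: real ^ 'n \<Rightarrow> int. True}"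
    then obtain c :: "real ^ 'n \<Rightarrow> int" where x: "x = (\<Sum>b\<in>B. of_int (c b) *\<^sub>R b)" by auto
    have nth: "x $ k = (if k = j then - (\<Sum>i\<in>UNIV - {j}. of_int (c (h i))) else of_int (c (h k)))" for k
      unfolding x sumB by (rule sum_nth)
    have "(\<Sum>k\<in>UNIV. x $ k) = x $ j + (\<Sum>k\<in>UNIV - {j}. x $ k)"
      by (simp add: sum.remove)
    also have "(\<Sum>k\<in>UNIV - {j}. x $ k) = (\<Sum>i\<in>UNIV - {j}. of_int (c (h i)))"
      by (rule sum.cong) (auto simp: nth)
    finally have "(\<Sum>k\<in>UNIV. x $ k) = 0" by (simp add: nth)
    moreover have "x $ k \<in> \<int>" for k by (auto simp: nth)
    ultimately show "x \<in> zero_sum_lattice" by (simp add: zero_sum_lattice_def)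
  next
    fix x :: "real ^ 'n" assume x: "x \<in> zero_sum_lattice"
    define c where "c b = \<lfloor>x $ (inv_into (UNIV - {j}) h b)\<rfloor>" for b
    have c: "of_int (c (h i)) = x $ i" if "i \<noteq> j" for i
      using that x inj by (simp add: c_def zero_sum_lattice_def)
    have "x $ k = (\<Sum>b\<in>B. of_int (c b) *\<^sub>R b) $ k" for k
    proof (cases "k = j")
      case True
      have "(\<Sum>i\<in>UNIV - {j}. of_int (c (h i))) = (\<Sum>i\<in>UNIV - {j}. x $ i)"
        by (rule sum.cong) (auto simp: c)
      moreover have "(\<Sum>k\<in>UNIV. x $ k) = x $ j + (\<Sum>k\<in>UNIV - {j}. x $ k)"
        by (simp add: sum.remove)
      ultimately show ?thesis unfolding sumB sum_nth using True x
        by (simp add: zero_sum_lattice_def)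
    next
      case False
      then show ?thesis unfolding sumB sum_nth by (simp add: c)
    qed
    then have "x = (\<Sum>b\<in>B. of_int (c b) *\<^sub>R b)" by (simp add: vec_eq_iff)
    then show "x \<in> {(\<Sum>b\<in>B. of_int (c b) *\<^sub>R b) | c :: real ^ 'n \<Rightarrow> int. True}" by blast
  qed
  ultimately show ?thesis unfolding lattice_basis_def by blast
qed

lemma det_in_Ints:
  fixes A :: "real ^ 'n ^ 'n::finite"
  assumes "\<And>i j. A $ i $ j \<in> \<int>"
  shows "det A \<in> \<int>"
  unfolding det_def using assms by (intro Ints_sum Ints_mult Ints_prod) (auto simp: sign_def)

lemma euclidean_vol_parallelepiped:
  fixes B :: "(real ^ 'n::{finite,wellorder}) set"
  assumes "lattice_basis B zero_sum_lattice"
  shows "euclidean_vol (parallelepiped B) = sqrt (real CARD('n))"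
proof -
  have ind: "independent B"
    and L: "{(\<Sum>b\<in>B. of_int (c b) *\<^sub>R b) | c :: (real, 'n) vec \<Rightarrow> int. True} = zero_sum_lattice"
    using assms by (auto simp: lattice_basis_def)
  have finB: "finite B" using ind by (rule independent_imp_finite)
  have BL: "b \<in> zero_sum_lattice" if "b \<in> B" for b
  proof -
    have "(\<Sum>b'\<in>B. of_int (if b' = b then 1 else 0) *\<^sub>R b') = (\<Sum>b'\<in>B. if b' = b then b' else 0)"
      by (rule sum.cong) auto
    also have "\<dots> = b" using that finB by simp
    finally have "b = (\<Sum>b'\<in>B. of_int (if b' = b then 1 else 0) *\<^sub>R b')" by simp
    then have "\<exists>c :: (real, 'n) vec \<Rightarrow> int. b = (\<Sum>b'\<in>B. of_int (c b') *\<^sub>R b')"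
      by (intro exI[of _ "\<lambda>b'. if b' = b then 1 else 0"])
    then show ?thesis unfolding L[symmetric] by blast
  qed
  define H where "H = {x :: (real, 'n) vec. 1 \<bullet> x = 0}"
  have H_iff: "x \<in> H \<longleftrightarrow> (\<Sum>i\<in>UNIV. x $ i) = 0" for x
    by (simp add: H_def inner_vec_def)
  obtain j :: 'n where True by simp
  have "span B = H"
  proof
    have "subspace H" unfolding H_def by (rule subspace_hyperplane)
    moreover have "B \<subseteq> H" using BL by (auto simp: H_iff zero_sum_lattice_def)
    ultimately show "span B \<subseteq> H" by (simp add: span_minimal)
  next
    have ax: "axis i 1 - axis j 1 \<in> span B" for i
    proof -
      have "axis i 1 - axis j 1 \<in> (zero_sum_lattice :: ((real, 'n) vec) set)"
        by (auto simp: zero_sum_lattice_def axis_def sum_subtractf)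
      then obtain c :: "(real, 'n) vec \<Rightarrow> int" where "axis i 1 - axis j 1 = (\<Sum>b\<in>B. of_int (c b) *\<^sub>R b)"
        unfolding L[symmetric] by blast
      then show ?thesis by (simp add: span_sum span_scale span_base)
    qed
    show "H \<subseteq> span B"
    proof
      fix x assume "x \<in> H"
      have "(\<Sum>i\<in>UNIV. x $ i *\<^sub>R (axis i 1 - axis j 1)) = x - (\<Sum>i\<in>UNIV. x $ i) *\<^sub>R axis j 1"
        using basis_expansion[of x]
        by (simp add: scaleR_diff_right sum_subtractf scaleR_sum_left scalar_mult_eq_scaleR)
      then have "x = (\<Sum>i\<in>UNIV. x $ i *\<^sub>R (axis i 1 - axis j 1))"
        using \<open>x \<in> H\<close> by (simp add: H_iff)
      also have "\<dots> \<in> span B" by (intro span_sum span_scale ax)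
      finally show "x \<in> span B" .
    qed
  qed
  then have "card B = dim H" using ind by (metis dim_span_eq_card_independent)
  also have "dim H = CARD('n) - 1"
    unfolding H_def by (subst dim_hyperplane) (auto simp: vec_eq_iff)
  finally have "card (UNIV - {j}) = card B" by simp
  then obtain h where h: "bij_betw h (UNIV - {j}) B"
    using finB by (metis finite finite_same_card_bij)
  then have hB: "h i \<in> B" if "i \<noteq> j" for i using that by (auto simp: bij_betw_def)
  have sumB: "(\<Sum>b\<in>B. f b) = (\<Sum>i\<in>UNIV - {j}. f (h i))" for f :: "(real, 'n) vec \<Rightarrow> (real, 'n) vec"
    by (rule sum.reindex_bij_betw[OF h, symmetric])
  define G where "G = (\<chi> k i. if i = j then (axis j 1 :: (real, 'n) vec) $ k else h i $ k)"
  have Gv: "G *v x = (\<Sum>i\<in>UNIV - {j}. x $ i *\<^sub>R h i) + x $ j *\<^sub>R axis j 1" for x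
    unfolding vec_eq_iff
    by (simp add: matrix_vector_mult_def G_def sum.remove[of UNIV j] mult.commute add.commute)
  have "\<exists>w. G *v w = axis i 1 \<and> (\<forall>k. w $ k \<in> \<int>)" for i
  proof -
    have "axis i 1 - axis j 1 \<in> (zero_sum_lattice :: ((real, 'n) vec) set)"
      by (auto simp: zero_sum_lattice_def axis_def sum_subtractf)
    then obtain c :: "(real, 'n) vec \<Rightarrow> int" where c: "axis i 1 - axis j 1 = (\<Sum>b\<in>B. of_int (c b) *\<^sub>R b)"
      unfolding L[symmetric] by blast
    define w :: "(real, 'n) vec" where "w = (\<chi> k. if k = j then 1 else of_int (c (h k)))"
    have "G *v w = (\<Sum>i\<in>UNIV - {j}. of_int (c (h i)) *\<^sub>R h i) + axis j 1"
      by (simp add: Gv w_def)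
    also have "\<dots> = axis i 1" using c by (simp add: sumB algebra_simps)
    finally show ?thesis by (intro exI[of _ w]) (auto simp: w_def)
  qed
  then obtain w where w: "\<And>i. G *v w i = axis i 1" "\<And>i k. w i $ k \<in> \<int>" by metis
  define K where "K = (\<chi> k i. w i $ k)"
  have "(G ** K) $ k $ i = mat 1 $ k $ i" for k i
  proof -
    have "(G ** K) $ k $ i = (G *v w i) $ k"
      by (simp add: matrix_matrix_mult_def matrix_vector_mult_def K_def)
    then show ?thesis by (simp add: w mat_def axis_def)
  qed
  then have GK: "G ** K = mat 1" by (simp add: vec_eq_iff)
  have "det G \<in> \<int>" using BL hB
    by (intro det_in_Ints) (auto simp: G_def axis_def zero_sum_lattice_def)
  moreover have "det K \<in> \<int>" using w by (intro det_in_Ints) (auto simp: K_def)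
  moreover have "det G * det K = 1" using GK by (metis det_I det_mul)
  ultimately obtain a b :: int where ab: "det G = of_int a" "a * b = 1"
    by (metis Ints_cases of_int_mult of_int_eq_1_iff)
  have "\<bar>a\<bar> = 1" using abs_zmult_eq_1[of a b] ab by simp
  then have detG: "\<bar>det G\<bar> = 1" using ab by (metis of_int_abs of_int_1)

  define m where "m = K *v unit_normal"
  have Gm: "G *v m = unit_normal"
    by (simp add: m_def matrix_vector_mul_assoc GK)
  have "(\<Sum>k\<in>UNIV. (G *v m) $ k) =
      (\<Sum>i\<in>UNIV - {j}. m $ i * (\<Sum>k\<in>UNIV. h i $ k)) + m $ j * (\<Sum>k\<in>UNIV. axis j 1 $ k)"
    unfolding Gv by (simp add: sum.distrib sum_distrib_left sum.swap[of _ _ "UNIV - {j}"])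
  also have "(\<Sum>i\<in>UNIV - {j}. m $ i * (\<Sum>k\<in>UNIV. h i $ k)) = 0"
    using BL hB by (intro sum.neutral) (auto simp: zero_sum_lattice_def)
  finally have "m $ j = (\<Sum>k\<in>UNIV. (G *v m) $ k)"
    by (simp add: axis_def)
  also have "\<dots> = sqrt (real CARD('n))"
    unfolding Gm by (simp add: unit_normal_def real_div_sqrt)
  finally have mj: "m $ j = sqrt (real CARD('n))" .

  define F where "F = (\<chi> k i. if i = j then (G *v m) $ k else G $ k $ i)"
  have "det F = sqrt (real CARD('n)) * det G"
    unfolding F_def by (simp only: cramer_lemma mj)
  then have detF: "\<bar>det F\<bar> = sqrt (real CARD('n))"
    using detG by (simp add: abs_mult)
  have Fv: "F *v x = (\<Sum>i\<in>UNIV - {j}. x $ i *\<^sub>R h i) + x $ j *\<^sub>R unit_normal" for x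
    unfolding vec_eq_iff F_def Gm
    by (simp add: matrix_vector_mult_def G_def
          sum.remove[of UNIV j] mult.commute add.commute)
  have "prism (parallelepiped B) = (*v) F ` cbox 0 1"
  proof (intro equalityI subsetI)
    fix y assume "y \<in> prism (parallelepiped B)"
    then obtain t s where y: "y = (\<Sum>b\<in>B. t b *\<^sub>R b) + s *\<^sub>R unit_normal"
      and t: "\<forall>b\<in>B. 0 \<le> t b \<and> t b \<le> 1" and s: "0 \<le> s" "s \<le> 1"
      unfolding prism_def parallelepiped_def by blast
    define x :: "(real, 'n) vec" where "x = (\<chi> i. if i = j then s else t (h i))"
    have "y = F *v x" unfolding y Fv by (simp add: sumB x_def)
    moreover have "x \<in> cbox 0 1" using t s hB by (auto simp: mem_box_cart x_def)
    ultimately show "y \<in> (*v) F ` cbox 0 1" by blast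
  next
    fix y assume "y \<in> (*v) F ` cbox 0 1"
    then obtain x where y: "y = F *v x" and x: "\<And>i. 0 \<le> x $ i \<and> x $ i \<le> 1"
      by (auto simp: mem_box_cart)
    define t where "t b = x $ (inv_into (UNIV - {j}) h b)" for b
    have "t (h i) = x $ i" if "i \<noteq> j" for i
      using that h by (simp add: t_def bij_betw_def)
    then have "y = (\<Sum>b\<in>B. t b *\<^sub>R b) + x $ j *\<^sub>R unit_normal"
      unfolding y Fv sumB by simp
    moreover have "(\<Sum>b\<in>B. t b *\<^sub>R b) \<in> parallelepiped B"
      unfolding parallelepiped_def using x by (auto simp: t_def)
    ultimately show "y \<in> prism (parallelepiped B)"
      unfolding prism_def using x by blast
  qed
  then have "euclidean_vol (parallelepiped B) = \<bar>det F\<bar> * measure lebesgue (cbox 0 1 :: ((real, 'n) vec) set)"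
    unfolding euclidean_vol_def by (simp add: measure_linear_image)
  also have "measure lebesgue (cbox 0 1 :: ((real, 'n) vec) set) = 1"
    by (subst measure_completion) (auto simp: content_cbox_cart interval_eq_empty_cart)
  finally show ?thesis by (simp add: detF)
qed

lemma Vol_eq:
  fixes A :: "(real ^ 'n::{finite,wellorder}) set"
  shows "Vol A = euclidean_vol A / sqrt (real CARD('n))"
  unfolding Vol_def
  by (subst euclidean_vol_parallelepiped) (auto intro: someI_ex lattice_basis_exists)

lemma Vol_parallelepiped:
  fixes B :: "(real ^ 'n::{finite,wellorder}) set"
  assumes "lattice_basis B zero_sum_lattice"
  shows "Vol (parallelepiped B) = 1"
  by (simp add: Vol_eq euclidean_vol_parallelepiped[OF assms])

section \<open>Generalised permutohedra\<close>

definition submodular :: "('n set \<Rightarrow> real) \<Rightarrow> bool" where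
  "submodular z \<longleftrightarrow> (\<forall>I J. z I + z J \<ge> z (I \<union> J) + z (I \<inter> J))"

definition gen_permutohedron :: "('n::finite set \<Rightarrow> real) \<Rightarrow> (real ^ 'n) set" where
  "gen_permutohedron z =
     {x. (\<Sum>i\<in>UNIV. x $ i) = z UNIV \<and> (\<forall>I. (\<Sum>i\<in>I. x $ i) \<le> z I)}"

section \<open>The summation\<close>

definition int_binomial :: "int \<Rightarrow> int \<Rightarrow> real" where
  "int_binomial a b = (if b < 0 \<or> b > a then 0 else real (nat a choose nat b))"

definition multinomial :: "nat \<Rightarrow> nat list \<Rightarrow> real" where
  "multinomial d ds = fact d / (\<Prod>e\<leftarrow>ds. fact e)"

text \<open>
  A chain $I_1 \subsetneq \dots \subsetneq I_k$ and a tuple $(d_1,\dots,d_k)$ are lists \<open>Is\<close>, \<open>ds\<close>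
  of the same length \<open>k\<close>, indexed from 0.  The empty chain \<open>k = 0\<close> is allowed; it occurs
  exactly when \<open>n = 1\<close>.
\<close>

definition chain_tuples :: "('n::finite set list \<times> nat list) set" where
  "chain_tuples = {(Is, ds). length Is = length ds \<and>
     sorted_wrt (\<subset>) ({} # Is @ [UNIV]) \<and>
     (\<forall>e\<in>set ds. 0 < e) \<and> sum_list ds = CARD('n) - 1}"

lemma finite_chain_tuples: "finite (chain_tuples :: ('n::finite set list \<times> nat list) set)"
proof -
  let ?n = "CARD('n) - 1"
  have len: "length ds \<le> sum_list ds" if "\<forall>e\<in>set ds. 0 < e" for ds :: "nat list"
    using that by (induction ds) auto
  have "Is \<in> {Is :: 'n set list. set Is \<subseteq> UNIV \<and> length Is \<le> ?n} \<and>
        ds \<in> {ds. set ds \<subseteq> {..?n} \<and> length ds \<le> ?n}"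
    if "(Is, ds) \<in> chain_tuples" for Is :: "'n set list" and ds
    using that len[of ds] member_le_sum_list[of _ ds] by (fastforce simp: chain_tuples_def)
  then have "chain_tuples \<subseteq> {Is :: 'n set list. set Is \<subseteq> UNIV \<and> length Is \<le> ?n} \<times>
          {ds. set ds \<subseteq> {..?n} \<and> length ds \<le> ?n}"
    by fast
  then show ?thesis
    by (rule finite_subset) (intro finite_cartesian_product finite_lists_length_le; simp)
qed

definition partial_sum :: "nat list \<Rightarrow> nat \<Rightarrow> nat" where
  "partial_sum ds i = sum_list (take (Suc i) ds)"

end

theory Submission
  imports Defs
begin

text \<open>
  For sets \<open>A \<subset> B\<close> the restriction of \<open>z\<close> to the Boolean interval from \<open>A\<close> to \<open>B\<close> cuts out a
  generalised permutohedron in the coordinates \<open>B - A\<close>.  Its facet with normal vector \<open>e\<^sub>I\<close> is the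
  product of the polytopes of \<open>(A, I)\<close> and \<open>(I, B)\<close>, so its volume, as a polynomial in \<open>z\<close>, has
  partial derivative \<open>vol (A, I) * vol (I, B)\<close> with respect to \<open>z I\<close>; when \<open>z\<close> vanishes strictly
  between \<open>A\<close> and \<open>B\<close>, the polytope is a Minkowski sum of two opposite simplices.  Integrating
  these two facts gives a sum over chains, the polynomial \<open>vol_poly\<close>.

  Conversely, intersecting with \<open>x\<^sub>i \<le> t\<close> replaces \<open>z\<close> by another submodular function, linear
  in \<open>t\<close> between finitely many break points.  In the derivative of \<open>vol_poly\<close> along this path all
  products but one contain the polynomial of a flat polytope, which is zero, and the remaining
  one is that of the slice \<open>x\<^sub>i = t\<close>.  Hence Fubini and induction on the dimension identify
  \<open>vol_poly\<close> with the volume.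
\<close>

section \<open>The chain polynomial\<close>

text \<open>Divided powers keep derivatives free of scalar factors; their factorials reassemble into
  the multinomial coefficient at the end.\<close>

definition dpow :: "nat \<Rightarrow> real \<Rightarrow> real" where
  "dpow k x = x ^ k / fact k"

lemma dpow_0 [simp]: "dpow 0 x = 1"
  by (simp add: dpow_def)

lemma dpow_at_0: "dpow k 0 = (if k = 0 then 1 else 0)"
  by (simp add: dpow_def)

lemma has_real_derivative_dpow_Suc [derivative_intros]:
  assumes "(f has_real_derivative f') (at s within X)"
  shows "((\<lambda>s. dpow (Suc k) (f s)) has_real_derivative dpow k (f s) * f') (at s within X)"
proof -
  have "f' * ((1 + real k) * f s ^ k) / fact (Suc k) = f s ^ k / fact k * f'"
    by (simp add: divide_simps add.commute mult.commute)
  then show ?thesis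
    using DERIV_cdivide[OF DERIV_power_Suc[OF assms, of k], of "fact (Suc k)"] by (simp add: dpow_def mult_ac)
qed

lemma continuous_on_dpow [continuous_intros]:
  "continuous_on X f \<Longrightarrow> continuous_on X (\<lambda>s. dpow k (f s))"
  unfolding dpow_def by (intro continuous_intros) auto

text \<open>
  A gap of size \<open>m\<close> between two consecutive sets of a chain contributes
  \<open>(-1) ^ (m - 1) * (m - 1 choose b)\<close>, a divided power \<open>b\<close> of the value at its upper end and a divided
  power \<open>m - 1 - b\<close> of the value at its lower end.  A set strictly inside the chain meets two gaps,
  and \<open>kern_int\<close> integrates the product of the two divided powers it receives.
\<close>

definition kern :: "nat \<Rightarrow> nat \<Rightarrow> real \<Rightarrow> real" where
  "kern m b x = (-1) ^ (m - 1) * real ((m - 1) choose b) * dpow (m - 1 - b) x"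

definition kern_int :: "nat \<Rightarrow> nat \<Rightarrow> nat \<Rightarrow> real \<Rightarrow> real" where
  "kern_int m b b' x = (-1) ^ (m - 1) * real ((m - 1) choose b) *
     (x ^ Suc (b' + (m - 1 - b)) / (real (Suc (b' + (m - 1 - b))) * fact b' * fact (m - 1 - b)))"

lemma kern_int_0 [simp]: "kern_int m b b' 0 = 0"
  by (simp add: kern_int_def)

lemma has_real_derivative_kern_int [derivative_intros]:
  assumes "(f has_real_derivative f') (at s within X)"
  shows "((\<lambda>s. kern_int m b b' (f s)) has_real_derivative dpow b' (f s) * kern m b (f s) * f') (at s within X)"
  unfolding kern_int_def kern_def dpow_def
  apply (rule derivative_eq_intros assms refl | simp del: of_nat_Suc power_Suc of_nat_add)+
  apply (simp add: field_simps power_add del: of_nat_Suc of_nat_add)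
  done

lemma continuous_on_kern_int [continuous_intros]:
  "continuous_on X f \<Longrightarrow> continuous_on X (\<lambda>s. kern_int m b b' (f s))"
  unfolding kern_int_def by (intro continuous_intros) auto

lemma continuous_on_kern [continuous_intros]:
  "continuous_on X f \<Longrightarrow> continuous_on X (\<lambda>s. kern m b (f s))"
  unfolding kern_def by (intro continuous_intros) auto

text \<open>
  \<open>chain_sum z A B b\<close> is the coefficient of the \<open>b\<close>-th divided power of \<open>z B\<close>; \<open>H\<close> is the last set of
  the chain before \<open>B\<close>.  Summing \<open>b'\<close> up to the same bound for every \<open>H\<close> is harmless because
  the terms with \<open>b' \<ge> card (H - A)\<close> vanish.
\<close>

function chain_sum :: "('n::finite set \<Rightarrow> real) \<Rightarrow> 'n set \<Rightarrow> 'n set \<Rightarrow> nat \<Rightarrow> real" where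
  "chain_sum z A B b = kern (card (B - A)) b (z A) +
     (\<Sum>H\<in>{A<..<B}. \<Sum>b'<CARD('n). kern_int (card (B - H)) b b' (z H) * chain_sum z A H b')"
  by pat_completeness auto
termination
  by (relation "Wellfounded.measure (\<lambda>(z, A, B, b). card B)") (auto intro: psubset_card_mono)

declare chain_sum.simps [simp del]

text \<open>Reattaches the divided powers of the top value. For \<open>A \<subset> B\<close> the
  coefficients with \<open>card (B - A) \<le> b\<close> vanish, so the uniform bound
  \<open>CARD('n)\<close> loses nothing.\<close>

definition vol_poly :: "('n::finite set \<Rightarrow> real) \<Rightarrow> 'n set \<Rightarrow> 'n set \<Rightarrow> real" where
  "vol_poly z A B = (\<Sum>b<CARD('n). dpow b (z B) * chain_sum z A B b)"

section \<open>Locality, continuity and derivatives of the chain polynomial\<close>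

text \<open>The value at \<open>B\<close> may differ: it enters only through the divided powers that
  \<open>vol_poly\<close> supplies.\<close>

lemma chain_sum_cong:
  fixes z z' :: "'n::finite set \<Rightarrow> real"
  assumes "A \<subset> B" "\<And>I. A \<subseteq> I \<Longrightarrow> I \<subset> B \<Longrightarrow> z I = z' I"
  shows "chain_sum z A B b = chain_sum z' A B b"
  using finite[of B] assms
proof (induction B arbitrary: b rule: finite_psubset_induct)
  case (psubset B)
  have "chain_sum z A H b' = chain_sum z' A H b'" if "H \<in> {A<..<B}" for H b'
  proof (rule psubset.IH)
    show "H \<subset> B" "A \<subset> H" using that by simp_all
    then show "z I = z' I" if "A \<subseteq> I" "I \<subset> H" for I
      using that by (intro psubset.prems(2)) blast+
  qed
  then show ?case
    using psubset.prems psubset_imp_subset[of A B]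
    unfolding chain_sum.simps[of _ A B b]
    by (intro arg_cong2[where f="(+)"] sum.cong refl arg_cong2[where f="(*)"]) (simp_all add: psubset_imp_subset)
qed

lemma vol_poly_cong:
  fixes z z' :: "'n::finite set \<Rightarrow> real"
  assumes "A \<subset> B" "\<And>I. A \<subseteq> I \<Longrightarrow> I \<subseteq> B \<Longrightarrow> z I = z' I"
  shows "vol_poly z A B = vol_poly z' A B"
proof -
  have "chain_sum z A B b = chain_sum z' A B b" for b
    using assms by (intro chain_sum_cong) auto
  moreover have "z B = z' B" using assms by auto
  ultimately show ?thesis by (simp add: vol_poly_def)
qed

lemma continuous_on_chain_sum:
  fixes \<zeta> :: "real \<Rightarrow> 'n::finite set \<Rightarrow> real"
  assumes "\<And>I. continuous_on X (\<lambda>s. \<zeta> s I)"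
  shows "continuous_on X (\<lambda>s. chain_sum (\<zeta> s) A B b)"
  using finite[of B]
proof (induction B arbitrary: b rule: finite_psubset_induct)
  case (psubset B)
  have "continuous_on X (\<lambda>s. \<Sum>H\<in>{A<..<B}. \<Sum>b'<CARD('n).
      kern_int (card (B - H)) b b' (\<zeta> s H) * chain_sum (\<zeta> s) A H b')"
    using psubset.IH
    by (intro continuous_on_sum continuous_on_mult continuous_on_kern_int assms) simp
  then show ?case
    unfolding chain_sum.simps[of _ A B b] by (intro continuous_on_add continuous_on_kern assms)
qed

lemma continuous_on_vol_poly:
  fixes \<zeta> :: "real \<Rightarrow> 'n::finite set \<Rightarrow> real"
  assumes "\<And>I. continuous_on X (\<lambda>s. \<zeta> s I)"
  shows "continuous_on X (\<lambda>s. vol_poly (\<zeta> s) A B)"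
  unfolding vol_poly_def by (intro continuous_intros continuous_on_chain_sum assms)

text \<open>The product rule hits either the value at the last set \<open>H\<close> or the inner
  \<open>chain_sum\<close>. In the first case \<open>kern_int\<close> differentiates to
  \<open>dpow\<close> times \<open>kern\<close>, and summing over \<open>b'\<close> gives
  \<open>vol_poly\<close> below \<open>H\<close> times the gap from \<open>H\<close> to
  \<open>B\<close>. In the second, exchanging the sums over \<open>I\<close> and \<open>H\<close>
  rebuilds the recursion of \<open>chain_sum\<close> from \<open>I\<close> to \<open>B\<close>. The
  term of the bottom value is stationary because \<open>\<delta> A = 0\<close>.\<close>

lemma has_real_derivative_chain_sum:
  fixes \<zeta> :: "real \<Rightarrow> 'n::finite set \<Rightarrow> real"
  assumes "\<And>I. ((\<lambda>s. \<zeta> s I) has_real_derivative \<delta> I) (at s within X)" and "\<delta> A = 0"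
  shows "((\<lambda>s. chain_sum (\<zeta> s) A B b) has_real_derivative
    (\<Sum>I\<in>{A<..<B}. \<delta> I * vol_poly (\<zeta> s) A I * chain_sum (\<zeta> s) I B b)) (at s within X)"
  using finite[of B]
proof (induction B arbitrary: b rule: finite_psubset_induct)
  case (psubset B)
  let ?k = "\<lambda>H b'. kern_int (card (B - H)) b b' (\<zeta> s H)"
  have kernA: "((\<lambda>s. kern m b (\<zeta> s A)) has_real_derivative 0) (at s within X)" for m
  proof (cases "m - 1 - b")
    case 0
    then show ?thesis by (simp add: kern_def)
  next
    case (Suc k)
    show ?thesis unfolding kern_def Suc
      by (rule derivative_eq_intros assms refl | simp add: assms)+
  qed
  have "((\<lambda>s. chain_sum (\<zeta> s) A B b) has_real_derivative
      0 + (\<Sum>H\<in>{A<..<B}. \<Sum>b'<CARD('n).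
         dpow b' (\<zeta> s H) * kern (card (B - H)) b (\<zeta> s H) * \<delta> H * chain_sum (\<zeta> s) A H b' +
         (\<Sum>I\<in>{A<..<H}. \<delta> I * vol_poly (\<zeta> s) A I * chain_sum (\<zeta> s) I H b') * ?k H b'))
      (at s within X)"
    unfolding chain_sum.simps[of _ A B b]
    by (intro DERIV_add DERIV_sum DERIV_mult has_real_derivative_kern_int kernA assms psubset.IH) auto
  also have "0 + (\<Sum>H\<in>{A<..<B}. \<Sum>b'<CARD('n).
         dpow b' (\<zeta> s H) * kern (card (B - H)) b (\<zeta> s H) * \<delta> H * chain_sum (\<zeta> s) A H b' +
         (\<Sum>I\<in>{A<..<H}. \<delta> I * vol_poly (\<zeta> s) A I * chain_sum (\<zeta> s) I H b') * ?k H b')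
    = (\<Sum>H\<in>{A<..<B}. \<delta> H * vol_poly (\<zeta> s) A H * kern (card (B - H)) b (\<zeta> s H)) +
      (\<Sum>H\<in>{A<..<B}. \<Sum>I\<in>{A<..<H}. \<delta> I * vol_poly (\<zeta> s) A I *
         (\<Sum>b'<CARD('n). ?k H b' * chain_sum (\<zeta> s) I H b'))"
  proof -
    have 1: "(\<Sum>b'<CARD('n). dpow b' (\<zeta> s H) * kern (card (B - H)) b (\<zeta> s H) * \<delta> H * chain_sum (\<zeta> s) A H b')
        = \<delta> H * vol_poly (\<zeta> s) A H * kern (card (B - H)) b (\<zeta> s H)" for H
      unfolding vol_poly_def sum_distrib_left sum_distrib_right by (simp add: mult_ac)
    have 2: "(\<Sum>b'<CARD('n). (\<Sum>I\<in>{A<..<H}. \<delta> I * vol_poly (\<zeta> s) A I * chain_sum (\<zeta> s) I H b') * ?k H b')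
        = (\<Sum>I\<in>{A<..<H}. \<delta> I * vol_poly (\<zeta> s) A I * (\<Sum>b'<CARD('n). ?k H b' * chain_sum (\<zeta> s) I H b'))" for H
      unfolding sum_distrib_left sum_distrib_right by (subst sum.swap) (simp add: mult_ac)
    show ?thesis by (simp only: sum.distrib 1 2 add_0)
  qed
  also have "(\<Sum>H\<in>{A<..<B}. \<Sum>I\<in>{A<..<H}. \<delta> I * vol_poly (\<zeta> s) A I *
         (\<Sum>b'<CARD('n). ?k H b' * chain_sum (\<zeta> s) I H b')) =
      (\<Sum>I\<in>{A<..<B}. \<Sum>H\<in>{I<..<B}. \<delta> I * vol_poly (\<zeta> s) A I *
         (\<Sum>b'<CARD('n). ?k H b' * chain_sum (\<zeta> s) I H b'))"
  proof -
    have "{A<..<H} = {I\<in>{A<..<B}. I \<subset> H}" if "H \<in> {A<..<B}" for H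
      using that by (simp add: set_eq_iff) (meson psubset_trans)
    moreover have "{I<..<B} = {H\<in>{A<..<B}. I \<subset> H}" if "I \<in> {A<..<B}" for I
      using that by (simp add: set_eq_iff) (meson psubset_trans)
    ultimately show ?thesis
      using sum.swap_restrict[of "{A<..<B}" "{A<..<B}" _ "\<lambda>H I. I \<subset> H"] by simp
  qed
  finally show ?case
    by (simp add: chain_sum.simps[of _ _ B b] distrib_left sum.distrib sum_distrib_left)
qed

text \<open>The facet rule. Later identities of polynomials come from comparing derivatives along a
  path that is stationary at \<open>A\<close> and \<open>B\<close>, together with the values at one
  point of the path.\<close>

lemma has_real_derivative_vol_poly:
  fixes \<zeta> :: "real \<Rightarrow> 'n::finite set \<Rightarrow> real"
  assumes "\<And>I. ((\<lambda>s. \<zeta> s I) has_real_derivative \<delta> I) (at s within X)" and "\<delta> A = 0" "\<delta> B = 0"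
  shows "((\<lambda>s. vol_poly (\<zeta> s) A B) has_real_derivative
    (\<Sum>I\<in>{A<..<B}. \<delta> I * vol_poly (\<zeta> s) A I * vol_poly (\<zeta> s) I B)) (at s within X)"
proof -
  have dB: "((\<lambda>s. dpow b (\<zeta> s B)) has_real_derivative 0) (at s within X)" for b
  proof (cases b)
    case (Suc k)
    show ?thesis unfolding Suc
      by (rule derivative_eq_intros assms refl | simp add: assms)+
  qed auto
  have "((\<lambda>s. vol_poly (\<zeta> s) A B) has_real_derivative
      (\<Sum>b<CARD('n). 0 * chain_sum (\<zeta> s) A B b +
        (\<Sum>I\<in>{A<..<B}. \<delta> I * vol_poly (\<zeta> s) A I * chain_sum (\<zeta> s) I B b) * dpow b (\<zeta> s B)))
      (at s within X)"
    unfolding vol_poly_def[of _ A B]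
    by (intro DERIV_sum DERIV_mult dB has_real_derivative_chain_sum assms)
  also have "(\<Sum>b<CARD('n). 0 * chain_sum (\<zeta> s) A B b +
        (\<Sum>I\<in>{A<..<B}. \<delta> I * vol_poly (\<zeta> s) A I * chain_sum (\<zeta> s) I B b) * dpow b (\<zeta> s B)) =
      (\<Sum>I\<in>{A<..<B}. \<delta> I * vol_poly (\<zeta> s) A I * vol_poly (\<zeta> s) I B)"
    unfolding vol_poly_def[of _ _ B] sum_distrib_left sum_distrib_right mult_zero_left add_0
    by (subst sum.swap) (simp add: mult_ac)
  finally show ?thesis .
qed

text \<open>
  For \<open>x, y \<le> 0\<close> this is the volume of \<open>- x\<close> times the standard \<open>n\<close>-simplex plus \<open>- y\<close> times its
  reflection.
\<close>

definition simplex_poly :: "nat \<Rightarrow> real \<Rightarrow> real \<Rightarrow> real" where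
  "simplex_poly n x y = (-1) ^ n * (\<Sum>b\<le>n. real (n choose b) * dpow (n - b) x * dpow b y)"

text \<open>Since \<open>kern_int\<close> vanishes at 0, every chain with an intermediate set drops
  out, and the single gap from \<open>A\<close> to \<open>B\<close> remains.\<close>

lemma vol_poly_interior_0:
  fixes z :: "'n::finite set \<Rightarrow> real"
  assumes "A \<subset> B" "\<And>I. A \<subset> I \<Longrightarrow> I \<subset> B \<Longrightarrow> z I = 0"
  shows "vol_poly z A B = simplex_poly (card (B - A) - 1) (z A) (z B)"
proof -
  let ?m = "card (B - A)"
  have m: "?m > 0" "?m \<le> CARD('n)"
    using assms(1) by (auto simp: card_gt_0_iff intro: card_mono)
  have "chain_sum z A B b = kern ?m b (z A)" for b
    by (subst chain_sum.simps) (simp add: assms(2))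
  then have "vol_poly z A B = (\<Sum>b<CARD('n). dpow b (z B) * kern ?m b (z A))"
    by (simp add: vol_poly_def)
  also have "\<dots> = (\<Sum>b\<le>?m - 1. dpow b (z B) * kern ?m b (z A))"
    using m by (intro sum.mono_neutral_right) (auto simp: kern_def)
  finally show ?thesis
    by (simp add: simplex_poly_def kern_def sum_distrib_left mult_ac)
qed

section \<open>Calculus of simplex polynomials\<close>

lemma has_real_derivative_dpow:
  assumes "(f has_real_derivative f') (at s within X)"
  shows "((\<lambda>s. dpow k (f s)) has_real_derivative of_bool (0 < k) * dpow (k - 1) (f s) * f') (at s within X)"
  using has_real_derivative_dpow_Suc[OF assms] by (cases k) simp_all

lemma simplex_poly_commute: "simplex_poly n x y = simplex_poly n y x"
  unfolding simplex_poly_def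
  by (rule arg_cong2[where f="(*)", OF refl],
      rule sum.reindex_bij_witness[of _ "\<lambda>b. n - b" "\<lambda>b. n - b"])
     (auto simp: mult_ac binomial_symmetric[symmetric])

lemma simplex_poly_0_left: "simplex_poly n 0 y = (-1) ^ n * dpow n y"
proof -
  have "(\<Sum>b\<le>n. real (n choose b) * dpow (n - b) 0 * dpow b y) = (\<Sum>b\<le>n. if b = n then dpow n y else 0)"
    by (rule sum.cong) (auto simp: dpow_at_0)
  then show ?thesis by (simp add: simplex_poly_def)
qed

lemma simplex_poly_0_right: "simplex_poly n x 0 = (-1) ^ n * dpow n x"
  by (simp add: simplex_poly_commute[of n x] simplex_poly_0_left)

text \<open>Both partial derivatives are written in the same products of divided powers, so that a
  common shift of the two arguments merges the coefficients by Pascal's rule.\<close>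

lemma has_real_derivative_simplex_poly:
  assumes "(f has_real_derivative f') (at s within X)" "(g has_real_derivative g') (at s within X)"
  shows "((\<lambda>s. simplex_poly n (f s) (g s)) has_real_derivative
    (-1) ^ n * (\<Sum>b<n. (real (n choose b) * f' + real (n choose Suc b) * g') *
      (dpow (n - 1 - b) (f s) * dpow b (g s)))) (at s within X)"
proof -
  have "((\<lambda>s. simplex_poly n (f s) (g s)) has_real_derivative
    (-1) ^ n * (\<Sum>b\<le>n. real (n choose b) * (of_bool (0 < n - b) * dpow (n - b - 1) (f s) * f') * dpow b (g s) +
       (of_bool (0 < b) * dpow (b - 1) (g s) * g') * (real (n choose b) * dpow (n - b) (f s)))) (at s within X)"
    unfolding simplex_poly_def
    by (intro DERIV_cmult DERIV_sum DERIV_mult has_real_derivative_dpow assms)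
  moreover have "(\<Sum>b\<le>n. real (n choose b) * (of_bool (0 < n - b) * dpow (n - b - 1) (f s) * f') * dpow b (g s))
      = (\<Sum>b<n. real (n choose b) * f' * (dpow (n - 1 - b) (f s) * dpow b (g s)))"
    by (intro sum.mono_neutral_cong_right) (auto simp: diff_commute)
  moreover have "(\<Sum>b\<le>n. (of_bool (0 < b) * dpow (b - 1) (g s) * g') * (real (n choose b) * dpow (n - b) (f s)))
      = (\<Sum>b<n. real (n choose Suc b) * g' * (dpow (n - 1 - b) (f s) * dpow b (g s)))"
    by (subst sum.atMost_shift) (auto intro!: sum.cong)
  ultimately show ?thesis by (simp add: sum.distrib distrib_right)
qed

section \<open>Counting the sets of an interval by size\<close>

lemma sum_by_card:
  fixes f :: "nat \<Rightarrow> real"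
  assumes "finite S" "\<And>I. I \<in> S \<Longrightarrow> h I \<in> {1..<m}"
    and "\<And>p. p \<in> {1..<m} \<Longrightarrow> card {I \<in> S. h I = p} = c p"
  shows "(\<Sum>I\<in>S. f (h I)) = (\<Sum>p=1..<m. real (c p) * f p)"
proof -
  have "(\<Sum>I\<in>S. f (h I)) = (\<Sum>p=1..<m. \<Sum>I\<in>{I\<in>S. h I = p}. f (h I))"
    by (rule sum.group[symmetric]) (use assms in auto)
  also have "\<dots> = (\<Sum>p=1..<m. real (c p) * f p)"
    by (rule sum.cong) (auto simp: assms(3)[symmetric])
  finally show ?thesis .
qed

lemma card_interval_level:
  fixes A B :: "'n::finite set"
  assumes "A \<subset> B" "p \<in> {1..<card (B - A)}"
  shows "card {I\<in>{A<..<B}. card (I - A) = p} = card (B - A) choose p"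
proof -
  have "bij_betw (\<lambda>X. A \<union> X) {X. X \<subseteq> B - A \<and> card X = p} {I\<in>{A<..<B}. card (I - A) = p}"
  proof (rule bij_betw_byWitness[where f' = "\<lambda>I. I - A"])
    show "(\<union>) A ` {X. X \<subseteq> B - A \<and> card X = p} \<subseteq> {I \<in> {A<..<B}. card (I - A) = p}"
    proof clarify
      fix X assume X: "X \<subseteq> B - A" "p = card X"
      have "A \<union> X - A = X" using X by auto
      \<comment> \<open>The bounds on \<open>p\<close> keep out both ends of the interval.\<close>
      moreover have "X \<noteq> {}" "X \<noteq> B - A" using X assms by auto
      ultimately show "A \<union> X \<in> {A<..<B} \<and> card (A \<union> X - A) = card X"
        using X assms(1) by auto
    qed
  qed (use assms in auto)
  then have "card {I\<in>{A<..<B}. card (I - A) = p} = card {X. X \<subseteq> B - A \<and> card X = p}"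
    by (rule bij_betw_same_card[symmetric])
  then show ?thesis by (simp add: n_subsets)
qed

lemma card_interval_level_containing:
  fixes A B :: "'n::finite set"
  assumes "A \<subset> B" "i \<in> B - A" "p \<in> {1..<card (B - A)}"
  shows "card {I\<in>{I\<in>{A<..<B}. i \<in> I}. card (I - A) = p} = (card (B - A) - 1) choose (p - 1)"
proof -
  have "bij_betw (\<lambda>X. insert i (A \<union> X)) {X. X \<subseteq> B - A - {i} \<and> card X = p - 1}
     {I\<in>{I\<in>{A<..<B}. i \<in> I}. card (I - A) = p}"
  proof (rule bij_betw_byWitness[where f' = "\<lambda>I. I - A - {i}"])
    show "(\<lambda>X. insert i (A \<union> X)) ` {X. X \<subseteq> B - A - {i} \<and> card X = p - 1}
        \<subseteq> {I\<in>{I\<in>{A<..<B}. i \<in> I}. card (I - A) = p}"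
    proof (rule image_subsetI)
      fix X assume "X \<in> {X. X \<subseteq> B - A - {i} \<and> card X = p - 1}"
      then have X: "X \<subseteq> B - A - {i}" "card X = p - 1" by auto
      have "insert i (A \<union> X) - A = insert i X" using X assms(2) by auto
      moreover have "card (insert i X) = p"
        using X assms(3) by (subst card_insert_disjoint) auto
      moreover have "insert i X \<noteq> B - A" using \<open>card (insert i X) = p\<close> assms(3) by auto
      moreover have "A \<subset> insert i (A \<union> X)" "insert i (A \<union> X) \<subseteq> B"
        using X assms(1,2) by auto
      ultimately show "insert i (A \<union> X) \<in> {I\<in>{I\<in>{A<..<B}. i \<in> I}. card (I - A) = p}"
        by auto
    qed
  qed (use assms in auto)
  then have "card {I\<in>{I\<in>{A<..<B}. i \<in> I}. card (I - A) = p} = card {X. X \<subseteq> B - A - {i} \<and> card X = p - 1}"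
    by (rule bij_betw_same_card[symmetric])
  then show ?thesis using assms(2) by (simp add: n_subsets)
qed

lemma interval_cards:
  fixes A B I :: "'n::finite set"
  assumes "I \<in> {A<..<B}"
  shows "card (I - A) \<in> {1..<card (B - A)}" "card (B - I) = card (B - A) - card (I - A)"
proof -
  have "card (B - A) = card (I - A) + card (B - I)"
    using assms by (subst card_Un_disjoint[symmetric]) (auto intro!: arg_cong[where f=card])
  moreover have "card (I - A) > 0" "card (B - I) > 0"
    using assms by (auto simp: card_gt_0_iff)
  ultimately show "card (I - A) \<in> {1..<card (B - A)}" "card (B - I) = card (B - A) - card (I - A)"
    by auto
qed

text \<open>The product at \<open>I\<close> depends only on the size of \<open>I - A\<close>: with
  gaps \<open>Suc p\<close> and \<open>Suc q\<close>, where \<open>n = Suc (p + q)\<close>, it is a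
  sign times \<open>dpow p x * dpow q y\<close>. Grouping by size leaves the counts
  \<open>c\<close>, indexed by \<open>b = q\<close>.\<close>

lemma sum_simplex_products:
  fixes A B :: "'n::finite set"
  assumes "A \<subset> B" and n: "card (B - A) = Suc n" and S: "S \<subseteq> {A<..<B}"
    and c: "\<And>b. b < n \<Longrightarrow> card {I\<in>S. card (I - A) = n - b} = c b"
  shows "(\<Sum>I\<in>S. simplex_poly (card (I - A) - 1) x 0 * simplex_poly (card (B - I) - 1) 0 y) =
    - ((-1) ^ n * (\<Sum>b<n. real (c b) * (dpow (n - 1 - b) x * dpow b y)))"
proof -
  have "(\<Sum>I\<in>S. simplex_poly (card (I - A) - 1) x 0 * simplex_poly (card (B - I) - 1) 0 y) =
      (\<Sum>I\<in>S. - ((-1) ^ n) * (dpow (card (I - A) - 1) x * dpow (n - card (I - A)) y))"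
  proof (rule sum.cong[OF refl])
    fix I assume "I \<in> S"
    then have *: "card (I - A) \<in> {1..<Suc n}" "card (B - I) = Suc n - card (I - A)"
      using interval_cards[of I A B] S n by auto
    define p q where "p = card (I - A) - 1" and "q = card (B - I) - 1"
    then have pq: "card (I - A) = Suc p" "card (B - I) = Suc q" "n = Suc (p + q)"
      using * by auto
    have "n - Suc p = q" using pq by simp
    then show "simplex_poly (card (I - A) - 1) x 0 * simplex_poly (card (B - I) - 1) 0 y =
      - ((-1) ^ n) * (dpow (card (I - A) - 1) x * dpow (n - card (I - A)) y)"
      by (simp add: pq simplex_poly_0_left simplex_poly_0_right power_add)
  qed
  also have "\<dots> = (\<Sum>p=1..<Suc n. real (c (n - p)) * (- ((-1) ^ n) * (dpow (p - 1) x * dpow (n - p) y)))"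
  proof (rule sum_by_card)
    fix p assume "p \<in> {1..<Suc n}"
    then show "card {I \<in> S. card (I - A) = p} = c (n - p)"
      using c[of "n - p"] by auto
  qed (use S interval_cards(1)[of _ A B] n in auto)
  also have "\<dots> = (\<Sum>b<n. real (c b) * (- ((-1) ^ n) * (dpow (n - 1 - b) x * dpow b y)))"
    by (rule sum.reindex_bij_witness[of _ "\<lambda>b. n - b" "\<lambda>p. n - p"]) (auto simp: diff_commute)
  finally show ?thesis by (simp add: sum_distrib_left sum_negf mult_ac)
qed

section \<open>Translation invariance and flat polytopes\<close>

text \<open>A zero-dimensional polytope is a point.\<close>

lemma vol_poly_insert:
  assumes "i \<notin> A"
  shows "vol_poly z A (insert i A) = 1"
proof -
  have "insert i A - A = {i}" using assms by auto
  moreover have "vol_poly z A (insert i A) = simplex_poly (card (insert i A - A) - 1) (z A) (z (insert i A))"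
    using assms by (intro vol_poly_interior_0) blast+
  ultimately show ?thesis by (simp add: simplex_poly_def)
qed

text \<open>Base case of \<open>vol_poly_shift\<close>. With only the ends shifted, the polynomial
  is still a simplex polynomial; then the interior values move from 0 to their shifted values along
  \<open>\<zeta>\<close>. Undoing a shift by \<open>r\<close> on the shorter intervals, which
  \<open>IH\<close> permits, makes both factors of each derivative term explicit.\<close>

lemma vol_poly_shift_interior_0:
  fixes z :: "'n::finite set \<Rightarrow> real"
  defines "sh \<equiv> \<lambda>i r (z :: 'n set \<Rightarrow> real) I. z I + (if i \<in> I then r else 0)"
  assumes AB: "A \<subset> B" and int0: "\<And>I. A \<subset> I \<Longrightarrow> I \<subset> B \<Longrightarrow> z I = 0"
    and IH: "\<And>I r z. I \<in> {A<..<B} \<Longrightarrow>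
      vol_poly (sh i r z) A I = vol_poly z A I \<and> vol_poly (sh i r z) I B = vol_poly z I B"
  shows "vol_poly (sh i s z) A B = vol_poly z A B"
proof -
  obtain n where n: "card (B - A) = Suc n"
    using AB by (metis card_gt_0_iff gr0_implies_Suc finite Diff_eq_empty_iff psubset_eq subset_antisym)
  have z0: "vol_poly z A B = simplex_poly n (z A) (z B)"
    using vol_poly_interior_0[OF AB int0] n by simp
  consider "i \<notin> B" | "i \<in> A" | "i \<in> B - A" by auto
  then show ?thesis
  proof cases
    case 1
    then have "vol_poly (sh i s z) A B = vol_poly z A B"
      by (intro vol_poly_cong[OF AB]) (auto simp: sh_def)
    then show ?thesis .
  next
    case 2
    \<comment> \<open>Every set of the interval contains \<open>i\<close>, so all values are to rise
      by \<open>s\<close>: the ends at once, the interior with the parameter.\<close>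
    define \<zeta> where "\<zeta> r = (\<lambda>I. if I = A then z A + s else if I = B then z B + s else r)" for r
    let ?\<delta> = "\<lambda>I. if I = A \<or> I = B then 0 else 1 :: real"
    have AI: "vol_poly (\<zeta> r) A I = simplex_poly (card (I - A) - 1) (z A + s - r) 0"
      and IB: "vol_poly (\<zeta> r) I B = simplex_poly (card (B - I) - 1) 0 (z B + s - r)"
      if "I \<in> {A<..<B}" for r I
    proof -
      have "vol_poly (sh i (- r) (\<zeta> r)) A I = simplex_poly (card (I - A) - 1) (z A + s - r) 0"
        using that 2 AB by (subst vol_poly_interior_0) (auto simp: sh_def \<zeta>_def)
      then show "vol_poly (\<zeta> r) A I = simplex_poly (card (I - A) - 1) (z A + s - r) 0"
        using IH[OF that] by simp
      have "vol_poly (sh i (- r) (\<zeta> r)) I B = simplex_poly (card (B - I) - 1) 0 (z B + s - r)"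
        using that 2 AB by (subst vol_poly_interior_0) (auto simp: sh_def \<zeta>_def)
      then show "vol_poly (\<zeta> r) I B = simplex_poly (card (B - I) - 1) 0 (z B + s - r)"
        using IH[OF that] by simp
    qed
    \<comment> \<open>Both terms have the same derivative. They agree at \<open>r = 0\<close>, and
      at \<open>r = s\<close> the second is the unshifted polynomial.\<close>
    have "((\<lambda>r. vol_poly (\<zeta> r) A B - simplex_poly n (z A + s - r) (z B + s - r)) has_real_derivative 0) (at r)" for r
    proof -
      have "((\<lambda>r. \<zeta> r I) has_real_derivative ?\<delta> I) (at r)" for I
        using AB unfolding \<zeta>_def by (cases "I = A"; cases "I = B"; cases "i \<in> I") simp_all
      then have "((\<lambda>r. vol_poly (\<zeta> r) A B) has_real_derivative
          (\<Sum>I\<in>{A<..<B}. ?\<delta> I * vol_poly (\<zeta> r) A I * vol_poly (\<zeta> r) I B)) (at r)"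
        by (intro has_real_derivative_vol_poly) auto
      moreover have "(\<Sum>I\<in>{A<..<B}. ?\<delta> I * vol_poly (\<zeta> r) A I * vol_poly (\<zeta> r) I B) =
          (\<Sum>I\<in>{A<..<B}. simplex_poly (card (I - A) - 1) (z A + s - r) 0 *
             simplex_poly (card (B - I) - 1) 0 (z B + s - r))"
        by (rule sum.cong) (auto simp: AI IB)
      moreover have "\<dots> = - ((-1) ^ n * (\<Sum>b<n. real (Suc n choose Suc b) *
          (dpow (n - 1 - b) (z A + s - r) * dpow b (z B + s - r))))"
      proof (rule sum_simplex_products[OF AB n])
        fix b assume "b < n"
        then have "n - b \<in> {1..<card (B - A)}" using n by auto
        from card_interval_level[OF AB this] \<open>b < n\<close>
        show "card {I\<in>{A<..<B}. card (I - A) = n - b} = Suc n choose Suc b"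
          using n binomial_symmetric[of "Suc b" "Suc n"] by (simp del: binomial_Suc_Suc)
      qed simp
      moreover have "((\<lambda>r. simplex_poly n (z A + s - r) (z B + s - r)) has_real_derivative
          (-1) ^ n * (\<Sum>b<n. (real (n choose b) * (- 1) + real (n choose Suc b) * (- 1)) *
            (dpow (n - 1 - b) (z A + s - r) * dpow b (z B + s - r)))) (at r)"
        by (intro has_real_derivative_simplex_poly) (auto intro!: derivative_eq_intros)
      moreover have "(-1) ^ n * (\<Sum>b<n. (real (n choose b) * (- 1) + real (n choose Suc b) * (- 1)) *
            (dpow (n - 1 - b) (z A + s - r) * dpow b (z B + s - r))) =
          - ((-1) ^ n * (\<Sum>b<n. real (Suc n choose Suc b) *
          (dpow (n - 1 - b) (z A + s - r) * dpow b (z B + s - r))))"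
      \<comment> \<open>Pascal's rule: the number of all intermediate sets of one size is the sum of
        the two coefficients.\<close>
      proof -
        have "(\<Sum>b<n. (real (n choose b) * (- 1) + real (n choose Suc b) * (- 1)) *
            (dpow (n - 1 - b) (z A + s - r) * dpow b (z B + s - r))) =
          (\<Sum>b<n. - (real (Suc n choose Suc b) *
          (dpow (n - 1 - b) (z A + s - r) * dpow b (z B + s - r))))"
          by (rule sum.cong) (simp_all add: algebra_simps)
        then show ?thesis by (simp only: sum_negf mult_minus_right)
      qed
      ultimately show ?thesis by (auto dest: DERIV_diff)
    qed
    then have "vol_poly (\<zeta> s) A B - simplex_poly n (z A) (z B) =
        vol_poly (\<zeta> 0) A B - simplex_poly n (z A + s) (z B + s)"
      using DERIV_isconst_all[of "\<lambda>r. vol_poly (\<zeta> r) A B - simplex_poly n (z A + s - r) (z B + s - r)" s 0]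
      by simp
    moreover have "vol_poly (\<zeta> 0) A B = simplex_poly n (z A + s) (z B + s)"
      using AB n by (subst vol_poly_interior_0) (auto simp: \<zeta>_def)
    moreover have "vol_poly (sh i s z) A B = vol_poly (\<zeta> s) A B"
      using 2 int0 by (intro vol_poly_cong[OF AB]) (auto simp: sh_def \<zeta>_def)
    ultimately show ?thesis by (simp add: z0)
  next
    case 3
    \<comment> \<open>Now the bottom value stays, and only intermediate sets containing
      \<open>i\<close> move; they are counted by a single binomial coefficient.\<close>
    define \<zeta> where "\<zeta> r = (\<lambda>I. if I = A then z A else if I = B then z B + s else if i \<in> I then r else 0)" for r
    let ?\<delta> = "\<lambda>I. if I = A \<or> I = B \<or> i \<notin> I then 0 else 1 :: real"
    have AI: "vol_poly (\<zeta> r) A I = simplex_poly (card (I - A) - 1) (z A) 0"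
      and IB: "vol_poly (\<zeta> r) I B = simplex_poly (card (B - I) - 1) 0 (z B + s - r)"
      if "I \<in> {A<..<B}" "i \<in> I" for r I
    proof -
      have "vol_poly (sh i (- r) (\<zeta> r)) A I = simplex_poly (card (I - A) - 1) (z A) 0"
        using that 3 AB by (subst vol_poly_interior_0) (auto simp: sh_def \<zeta>_def)
      then show "vol_poly (\<zeta> r) A I = simplex_poly (card (I - A) - 1) (z A) 0"
        using IH[OF that(1)] by simp
      have "vol_poly (sh i (- r) (\<zeta> r)) I B = simplex_poly (card (B - I) - 1) 0 (z B + s - r)"
        using that 3 AB by (subst vol_poly_interior_0) (auto simp: sh_def \<zeta>_def)
      then show "vol_poly (\<zeta> r) I B = simplex_poly (card (B - I) - 1) 0 (z B + s - r)"
        using IH[OF that(1)] by simp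
    qed
    have "((\<lambda>r. vol_poly (\<zeta> r) A B - simplex_poly n (z A) (z B + s - r)) has_real_derivative 0) (at r)" for r
    proof -
      have "((\<lambda>r. \<zeta> r I) has_real_derivative ?\<delta> I) (at r)" for I
        using AB unfolding \<zeta>_def by (cases "I = A"; cases "I = B"; cases "i \<in> I") simp_all
      then have "((\<lambda>r. vol_poly (\<zeta> r) A B) has_real_derivative
          (\<Sum>I\<in>{A<..<B}. ?\<delta> I * vol_poly (\<zeta> r) A I * vol_poly (\<zeta> r) I B)) (at r)"
        by (intro has_real_derivative_vol_poly) auto
      moreover have "(\<Sum>I\<in>{A<..<B}. ?\<delta> I * vol_poly (\<zeta> r) A I * vol_poly (\<zeta> r) I B) =
          (\<Sum>I\<in>{I\<in>{A<..<B}. i \<in> I}. simplex_poly (card (I - A) - 1) (z A) 0 *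
             simplex_poly (card (B - I) - 1) 0 (z B + s - r))"
        by (rule sum.mono_neutral_cong_right) (auto simp: AI IB)
      moreover have "\<dots> = - ((-1) ^ n * (\<Sum>b<n. real (n choose Suc b) *
          (dpow (n - 1 - b) (z A) * dpow b (z B + s - r))))"
      proof (rule sum_simplex_products[OF AB n])
        fix b assume "b < n"
        then have "n - b \<in> {1..<card (B - A)}" using n by auto
        from card_interval_level_containing[OF AB 3 this] \<open>b < n\<close>
        show "card {I\<in>{I\<in>{A<..<B}. i \<in> I}. card (I - A) = n - b} = n choose Suc b"
          using n binomial_symmetric[of "Suc b" n] by simp
      qed auto
      moreover have "((\<lambda>r. simplex_poly n (z A) (z B + s - r)) has_real_derivative
          (-1) ^ n * (\<Sum>b<n. (real (n choose b) * 0 + real (n choose Suc b) * (- 1)) *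
            (dpow (n - 1 - b) (z A) * dpow b (z B + s - r)))) (at r)"
        by (intro has_real_derivative_simplex_poly) (auto intro!: derivative_eq_intros)
      ultimately show ?thesis by (auto dest: DERIV_diff simp: sum_negf)
    qed
    then have "vol_poly (\<zeta> s) A B - simplex_poly n (z A) (z B) =
        vol_poly (\<zeta> 0) A B - simplex_poly n (z A) (z B + s)"
      using DERIV_isconst_all[of "\<lambda>r. vol_poly (\<zeta> r) A B - simplex_poly n (z A) (z B + s - r)" s 0]
      by simp
    moreover have "vol_poly (\<zeta> 0) A B = simplex_poly n (z A) (z B + s)"
      using AB n by (subst vol_poly_interior_0) (auto simp: \<zeta>_def)
    moreover have "vol_poly (sh i s z) A B = vol_poly (\<zeta> s) A B"
      using 3 int0 by (intro vol_poly_cong[OF AB]) (auto simp: sh_def \<zeta>_def)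
    ultimately show ?thesis by (simp add: z0)
  qed
qed

text \<open>Adding \<open>s\<close> to all \<open>z I\<close> with \<open>i \<in> I\<close> translates the polytope by \<open>s\<close> in direction \<open>i\<close>.\<close>

lemma vol_poly_shift:
  fixes z :: "'n::finite set \<Rightarrow> real"
  assumes "A \<subset> B"
  shows "vol_poly (\<lambda>I. z I + (if i \<in> I then s else 0)) A B = vol_poly z A B"
  using assms
proof (induction "card (B - A)" arbitrary: A B z s rule: less_induct)
  case less
  let ?sh = "\<lambda>r (z :: 'n set \<Rightarrow> real) I. z I + (if i \<in> I then r else 0)"
  have IH: "vol_poly (?sh r z) A I = vol_poly z A I \<and> vol_poly (?sh r z) I B = vol_poly z I B"
    if "I \<in> {A<..<B}" for I r z
    using that interval_cards[OF that] by (intro conjI less.hyps) auto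
  \<comment> \<open>Scaling the interior values by \<open>r\<close> joins the base case at
    \<open>r = 0\<close> to \<open>z\<close> at \<open>r = 1\<close>. The derivatives with and
    without the shift agree because their factors belong to shorter intervals.\<close>
  define \<zeta> where "\<zeta> r = (\<lambda>I. if I = A \<or> I = B then z I else r * z I)" for r
  let ?\<delta> = "\<lambda>I. if I = A \<or> I = B then 0 else z I"
  have "((\<lambda>r. vol_poly (?sh s (\<zeta> r)) A B - vol_poly (\<zeta> r) A B) has_real_derivative 0) (at r)" for r
  proof -
    have d: "((\<lambda>r. \<zeta> r I) has_real_derivative ?\<delta> I) (at r)" for I
      unfolding \<zeta>_def by (auto intro!: derivative_eq_intros)
    then have "((\<lambda>r. vol_poly (\<zeta> r) A B) has_real_derivative
        (\<Sum>I\<in>{A<..<B}. ?\<delta> I * vol_poly (\<zeta> r) A I * vol_poly (\<zeta> r) I B)) (at r)"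
      by (intro has_real_derivative_vol_poly) auto
    moreover have "((\<lambda>r. ?sh s (\<zeta> r) I) has_real_derivative ?\<delta> I) (at r)" for I
      using DERIV_add[OF d[of I] DERIV_const] by simp
    then have "((\<lambda>r. vol_poly (?sh s (\<zeta> r)) A B) has_real_derivative
        (\<Sum>I\<in>{A<..<B}. ?\<delta> I * vol_poly (?sh s (\<zeta> r)) A I * vol_poly (?sh s (\<zeta> r)) I B)) (at r)"
      by (intro has_real_derivative_vol_poly) auto
    moreover have "(\<Sum>I\<in>{A<..<B}. ?\<delta> I * vol_poly (?sh s (\<zeta> r)) A I * vol_poly (?sh s (\<zeta> r)) I B) =
        (\<Sum>I\<in>{A<..<B}. ?\<delta> I * vol_poly (\<zeta> r) A I * vol_poly (\<zeta> r) I B)"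
      by (rule sum.cong[OF refl]) (simp only: IH)
    ultimately show ?thesis by (auto dest: DERIV_diff)
  qed
  then have "vol_poly (?sh s (\<zeta> 1)) A B - vol_poly (\<zeta> 1) A B = vol_poly (?sh s (\<zeta> 0)) A B - vol_poly (\<zeta> 0) A B"
    using DERIV_isconst_all[of "\<lambda>r. vol_poly (?sh s (\<zeta> r)) A B - vol_poly (\<zeta> r) A B" 1 0] by blast
  moreover have "vol_poly (?sh s (\<zeta> 0)) A B = vol_poly (\<zeta> 0) A B"
    by (rule vol_poly_shift_interior_0[OF less.prems _ IH]) (auto simp: \<zeta>_def)
  moreover have "\<zeta> 1 = z" by (auto simp: \<zeta>_def)
  ultimately show ?case by simp
qed

section \<open>Vanishing on flat polytopes\<close>

text \<open>Pascal's rule splits the sum into two parts, which in \<open>vol_poly_cylinder_0\<close>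
  arise by integrating over the values at \<open>insert i A\<close> and
  \<open>B - {i}\<close>.\<close>

lemma simplex_poly_Suc:
  "simplex_poly (Suc k) x y = - ((-1) ^ k * (\<Sum>b\<le>k. real (k choose b) *
     (dpow (Suc (k - b)) x * dpow b y + dpow (k - b) x * dpow (Suc b) y)))"
proof -
  let ?h = "\<lambda>b. real (k choose b) * dpow (Suc k - b) x * dpow b y"
  have "(\<Sum>b\<le>Suc k. real (Suc k choose b) * dpow (Suc k - b) x * dpow b y) =
      dpow (Suc k) x + (\<Sum>b\<le>k. real (Suc k choose Suc b) * dpow (k - b) x * dpow (Suc b) y)"
    by (subst sum.atMost_Suc_shift) simp
  also have "\<dots> = (\<Sum>b\<le>k. real (k choose b) * dpow (k - b) x * dpow (Suc b) y) +
      (?h 0 + (\<Sum>b\<le>k. ?h (Suc b)))"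
    by (simp add: sum.distrib algebra_simps)
  also have "?h 0 + (\<Sum>b\<le>k. ?h (Suc b)) = (\<Sum>b\<le>k. ?h b)"
    by (subst sum.atMost_Suc_shift[symmetric]) simp
  also have "\<dots> = (\<Sum>b\<le>k. real (k choose b) * (dpow (Suc (k - b)) x * dpow b y))"
    by (rule sum.cong) (auto simp: Suc_diff_le)
  finally show ?thesis
    unfolding simplex_poly_def by (simp add: sum.distrib distrib_left mult.assoc algebra_simps)
qed

text \<open>The hypothesis forces \<open>x\<^sub>i = 0\<close> on the polytope.\<close>

lemma vol_poly_cylinder_0:
  fixes z :: "'n::finite set \<Rightarrow> real"
  assumes "A \<subset> B" "i \<in> B - A" "2 \<le> card (B - A)"
    and "\<And>J. A \<subseteq> J \<Longrightarrow> J \<subseteq> B - {i} \<Longrightarrow> z (insert i J) = z J"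
  shows "vol_poly z A B = 0"
  using assms
proof (induction "card (B - A)" arbitrary: A B z rule: less_induct)
  case less
  note AB = less.prems(1) and i = less.prems(2) and c2 = less.prems(3) and cyl = less.prems(4)
  obtain k where k: "card (B - A) = Suc (Suc k)" using c2 by (metis Suc_le_D numeral_2_eq_2 Suc_le_mono)
  have ne: "insert i A \<noteq> B" "B - {i} \<noteq> A"
  proof -
    have "B - A \<noteq> {i}" using k by auto
    then show "insert i A \<noteq> B" "B - {i} \<noteq> A" using i by auto
  qed
  \<comment> \<open>Within the interval, \<open>S\<close> is stable under adding or removing
    \<open>i\<close>, so scaling the values outside it preserves the hypothesis.\<close>
  define S where "S = {A, insert i A, B - {i}, B}"
  define \<zeta> where "\<zeta> r = (\<lambda>I. if I \<in> S then z I else r * z I)" for r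
  let ?\<delta> = "\<lambda>I. if I \<in> S then 0 else z I"
  have \<zeta>_cyl: "\<zeta> r (insert i J) = \<zeta> r J" if "A \<subseteq> J" "J \<subseteq> B - {i}" for r J
  proof -
    have "insert i J \<in> S \<longleftrightarrow> J \<in> S"
      using that i unfolding S_def by auto
    then show ?thesis using cyl[OF that] by (simp add: \<zeta>_def)
  qed
  \<comment> \<open>Whichever of the intervals from \<open>A\<close> to \<open>I\<close> and from
    \<open>I\<close> to \<open>B\<close> has \<open>i\<close> in its difference inherits the
    hypothesis. Its size is at least 2, because the exceptions \<open>insert i A\<close> and
    \<open>B - {i}\<close> lie in \<open>S\<close>.\<close>
  have 0: "?\<delta> I * vol_poly (\<zeta> r) A I * vol_poly (\<zeta> r) I B = 0" if I: "I \<in> {A<..<B}" for r I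
  proof (cases "I \<in> S")
    case False
    show ?thesis
    proof (cases "i \<in> I")
      case True
      have "card (I - A) \<noteq> 1"
      proof
        assume "card (I - A) = 1"
        then obtain j where "I - A = {j}" by (auto simp: card_1_singleton_iff)
        then have "I - A = {i}" using True i by (metis DiffD2 DiffI singletonD)
        then have "I = insert i A" using True i I by auto
        then show False using False by (simp add: S_def)
      qed
      then have "vol_poly (\<zeta> r) A I = 0"
        using interval_cards[OF I] I True i
        by (intro less.hyps) (auto intro!: \<zeta>_cyl)
      then show ?thesis by simp
    next
      case iI: False
      have "card (B - I) \<noteq> 1"
      proof
        assume "card (B - I) = 1"
        then obtain j where "B - I = {j}" by (auto simp: card_1_singleton_iff)
        then have "B - I = {i}" using iI i by (metis DiffD1 DiffI singletonD)
        then have "I = B - {i}" using iI i I by auto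
        then show False using False by (simp add: S_def)
      qed
      then have "vol_poly (\<zeta> r) I B = 0"
        using interval_cards[OF I] I iI i
        by (intro less.hyps) (auto intro!: \<zeta>_cyl)
      then show ?thesis by simp
    qed
  qed simp
  have "((\<lambda>r. vol_poly (\<zeta> r) A B) has_real_derivative 0) (at r)" for r
  proof -
    have "((\<lambda>r. \<zeta> r I) has_real_derivative ?\<delta> I) (at r)" for I
      unfolding \<zeta>_def by (auto intro!: derivative_eq_intros)
    then have "((\<lambda>r. vol_poly (\<zeta> r) A B) has_real_derivative
        (\<Sum>I\<in>{A<..<B}. ?\<delta> I * vol_poly (\<zeta> r) A I * vol_poly (\<zeta> r) I B)) (at r)"
      by (intro has_real_derivative_vol_poly) (auto simp: S_def)
    then show ?thesis by (simp only: sum.neutral[OF ballI[OF 0]])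
  qed
  then have eq1: "vol_poly (\<zeta> 1) A B = vol_poly (\<zeta> 0) A B"
    using DERIV_isconst_all[of "\<lambda>r. vol_poly (\<zeta> r) A B" 1 0] by blast
  \<comment> \<open>What remains takes the value \<open>x\<close> on \<open>A\<close> and
    \<open>insert i A\<close>, \<open>y\<close> on \<open>B - {i}\<close> and \<open>B\<close>, and
    0 elsewhere. The path \<open>\<xi>\<close> starts from the two ends alone and raises both middle
    values together. The starting value is \<open>simplex_poly (Suc k) x y\<close>, and the gain
    \<open>M 1 - M 0\<close> is its negative.\<close>
  define x y where "x = z A" and "y = z B"
  define c d where "c I = (if I = A then x else if I = B then y else 0)"
    and "d I = (if I = A \<or> I = B then 0 else if I = insert i A then x else if I = B - {i} then y else 0)" for I
  define \<xi> where "\<xi> r = (\<lambda>I. c I + r * d I)" for r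
  define M where "M r = (-1) ^ k * (\<Sum>b\<le>k. real (k choose b) *
     (dpow (Suc (k - b)) (r * x) * dpow b y + dpow (k - b) x * dpow (Suc b) (r * y)))" for r
  have "((\<lambda>r. vol_poly (\<xi> r) A B - M r) has_real_derivative 0) (at r)" for r
  proof -
    have mem: "insert i A \<in> {A<..<B}" "B - {i} \<in> {A<..<B}" "insert i A \<noteq> B - {i}"
      using AB i ne by auto
    have cards: "card (B - insert i A) - 1 = k" "card (B - {i} - A) - 1 = k"
    proof -
      have "insert i A - A = {i}" "B - (B - {i}) = {i}" using i by auto
      then have "card (insert i A - A) = 1" "card (B - (B - {i})) = 1" by simp_all
      then show "card (B - insert i A) - 1 = k" "card (B - {i} - A) - 1 = k"
        using k interval_cards[OF mem(1)] interval_cards[OF mem(2)] by simp_all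
    qed
    have "((\<lambda>r. \<xi> r I) has_real_derivative d I) (at r)" for I
      unfolding \<xi>_def by (auto intro!: derivative_eq_intros)
    then have "((\<lambda>r. vol_poly (\<xi> r) A B) has_real_derivative
        (\<Sum>I\<in>{A<..<B}. d I * vol_poly (\<xi> r) A I * vol_poly (\<xi> r) I B)) (at r)"
      by (intro has_real_derivative_vol_poly) (auto simp: d_def)
    also have "(\<Sum>I\<in>{A<..<B}. d I * vol_poly (\<xi> r) A I * vol_poly (\<xi> r) I B) =
        (\<Sum>I\<in>{insert i A, B - {i}}. d I * vol_poly (\<xi> r) A I * vol_poly (\<xi> r) I B)"
      using mem by (intro sum.mono_neutral_right) (auto simp: d_def)
    also have "\<dots> = x * vol_poly (\<xi> r) A (insert i A) * vol_poly (\<xi> r) (insert i A) B +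
        y * vol_poly (\<xi> r) A (B - {i}) * vol_poly (\<xi> r) (B - {i}) B"
      using mem i by (subst sum.insert) (auto simp: d_def)
    also have "vol_poly (\<xi> r) A (insert i A) = 1"
      using i by (simp add: vol_poly_insert)
    also have "vol_poly (\<xi> r) (B - {i}) B = 1"
      using i vol_poly_insert[of i "B - {i}" "\<xi> r"] by (simp add: insert_absorb)
    also have "vol_poly (\<xi> r) (insert i A) B = simplex_poly k (r * x) y"
      using mem cards i AB by (subst vol_poly_interior_0) (auto simp: \<xi>_def c_def d_def)
    also have "vol_poly (\<xi> r) A (B - {i}) = simplex_poly k x (r * y)"
      using mem cards i AB by (subst vol_poly_interior_0) (auto simp: \<xi>_def c_def d_def)
    finally have "((\<lambda>r. vol_poly (\<xi> r) A B) has_real_derivative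
       x * 1 * simplex_poly k (r * x) y + y * simplex_poly k x (r * y) * 1) (at r)" .
    moreover have "(M has_real_derivative (-1) ^ k * (\<Sum>b\<le>k. real (k choose b) *
       (dpow (k - b) (r * x) * x * dpow b y + dpow b (r * y) * y * dpow (k - b) x))) (at r)"
      unfolding M_def
      by (intro DERIV_cmult DERIV_sum) (auto intro!: derivative_eq_intros)
    moreover have "(-1) ^ k * (\<Sum>b\<le>k. real (k choose b) *
       (dpow (k - b) (r * x) * x * dpow b y + dpow b (r * y) * y * dpow (k - b) x)) =
       x * 1 * simplex_poly k (r * x) y + y * simplex_poly k x (r * y) * 1"
      by (simp add: simplex_poly_def sum.distrib sum_distrib_left algebra_simps)
    ultimately show ?thesis by (auto dest: DERIV_diff)
  qed
  then have "vol_poly (\<xi> 1) A B - M 1 = vol_poly (\<xi> 0) A B - M 0"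
    using DERIV_isconst_all[of "\<lambda>r. vol_poly (\<xi> r) A B - M r" 1 0] by blast
  moreover have "M 0 = 0" by (simp add: M_def dpow_at_0)
  moreover have "M 1 = - simplex_poly (Suc k) x y" by (simp add: M_def simplex_poly_Suc)
  moreover have "vol_poly (\<xi> 0) A B = simplex_poly (Suc k) x y"
    using AB k by (subst vol_poly_interior_0) (auto simp: \<xi>_def c_def d_def)
  moreover have "vol_poly (\<zeta> 0) A B = vol_poly (\<xi> 1) A B"
  proof (rule vol_poly_cong[OF AB])
    fix I
    have "z (insert i A) = x" using cyl[of A] i AB by (simp add: x_def subset_Diff_insert psubset_imp_subset)
    moreover have "z (B - {i}) = y"
      using cyl[of "B - {i}"] i AB by (simp add: y_def subset_Diff_insert psubset_imp_subset insert_absorb)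
    ultimately show "\<zeta> 0 I = \<xi> 1 I"
      by (cases "I = A"; cases "I = B"; cases "I = insert i A"; cases "I = B - {i}")
         (simp_all add: \<zeta>_def \<xi>_def c_def d_def S_def x_def y_def)
  qed
  moreover have "\<zeta> 1 = z" by (auto simp: \<zeta>_def)
  ultimately show ?case using eq1 by simp
qed

text \<open>Translating by \<open>- t\<close> in direction \<open>i\<close> reduces this to
  \<open>vol_poly_cylinder_0\<close>.\<close>

lemma vol_poly_flat:
  fixes z :: "'n::finite set \<Rightarrow> real"
  assumes "A \<subset> B" "i \<in> B - A" "2 \<le> card (B - A)"
    and "\<And>J. A \<subseteq> J \<Longrightarrow> J \<subseteq> B - {i} \<Longrightarrow> z (insert i J) = z J + t"
  shows "vol_poly z A B = 0"
proof -
  have "vol_poly (\<lambda>I. z I + (if i \<in> I then - t else 0)) A B = 0"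
    using assms by (intro vol_poly_cylinder_0[of A B i]) auto
  then show ?thesis by (simp add: vol_poly_shift[OF assms(1)])
qed

section \<open>Slices and volumes\<close>

text \<open>The submodular function of the intersection with the half-space \<open>x\<^sub>i \<le> t\<close>.\<close>

definition truncate :: "('n::finite set \<Rightarrow> real) \<Rightarrow> 'n \<Rightarrow> real \<Rightarrow> 'n set \<Rightarrow> real" where
  "truncate z i t I = (if i \<in> I then min (z I) (z (I - {i}) + t) else z I)"

lemma submodularD: "submodular z \<Longrightarrow> z (I \<union> J) + z (I \<inter> J) \<le> z I + z J"
  by (simp add: submodular_def)

text \<open>Diminishing marginal values. On an interval they place the break points of
  \<open>truncate\<close> between the marginal at the top and the one at the bottom.\<close>

lemma submodular_marginal:
  assumes "submodular z" "i \<in> I" "J \<subseteq> I - {i}"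
  shows "z I - z (I - {i}) \<le> z (insert i J) - z J"
proof -
  have "insert i J \<union> (I - {i}) = I" "insert i J \<inter> (I - {i}) = J"
    using assms by auto
  then show ?thesis using submodularD[OF assms(1), of "insert i J" "I - {i}"] by simp
qed

lemma submodular_truncate:
  assumes "submodular z"
  shows "submodular (truncate z i t)"
  unfolding submodular_def
proof (intro allI)
  fix I J
  let ?z = "truncate z i t"
  have ub: "?z K \<le> z K" "i \<in> K \<Longrightarrow> ?z K \<le> z (K - {i}) + t" for K
    by (auto simp: truncate_def)
  have attained: "?z K = z K \<or> i \<in> K \<and> ?z K = z (K - {i}) + t" for K
    by (auto simp: truncate_def min_def)
  \<comment> \<open>Exactly one \<open>t\<close> is available: it is spent on the intersection if
    \<open>i\<close> lies in \<open>L\<close>, and on the union otherwise.\<close>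
  have mixed: "?z (K \<union> L) + ?z (K \<inter> L) \<le> z (K - {i}) + t + z L" if "i \<in> K" for K L
  proof (cases "i \<in> L")
    case True
    then have "(K - {i}) \<union> L = K \<union> L" "(K - {i}) \<inter> L = K \<inter> L - {i}" by auto
    then show ?thesis
      using submodularD[OF assms, of "K - {i}" L] ub(1)[of "K \<union> L"] ub(2)[of "K \<inter> L"] that True by simp
  next
    case False
    then have "(K - {i}) \<union> L = K \<union> L - {i}" "(K - {i}) \<inter> L = K \<inter> L" using that by auto
    then show ?thesis
      using submodularD[OF assms, of "K - {i}" L] ub(2)[of "K \<union> L"] ub(1)[of "K \<inter> L"] that by simp
  qed
  consider "?z I = z I" "?z J = z J"
    | "i \<in> I" "?z I = z (I - {i}) + t" "?z J = z J"
    | "i \<in> J" "?z J = z (J - {i}) + t" "?z I = z I"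
    | "i \<in> I" "i \<in> J" "?z I = z (I - {i}) + t" "?z J = z (J - {i}) + t"
    using attained[of I] attained[of J] by blast
  then show "?z (I \<union> J) + ?z (I \<inter> J) \<le> ?z I + ?z J"
  proof cases
    case 1
    then show ?thesis using submodularD[OF assms, of I J] ub(1)[of "I \<union> J"] ub(1)[of "I \<inter> J"] by linarith
  next
    case 2
    then show ?thesis using mixed[of I J] by simp
  next
    case 3
    then show ?thesis using mixed[of J I] by (simp add: Un_commute Int_commute)
  next
    case 4
    have "(I - {i}) \<union> (J - {i}) = I \<union> J - {i}" "(I - {i}) \<inter> (J - {i}) = I \<inter> J - {i}" by auto
    then show ?thesis
      using submodularD[OF assms, of "I - {i}" "J - {i}"] ub(2)[of "I \<union> J"] ub(2)[of "I \<inter> J"] 4 by simp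
  qed
qed

section \<open>Differentiating along a truncation\<close>

text \<open>Away from the break points, the truncated value at \<open>I\<close> moves with slope 1
  if \<open>t\<close> lies below the marginal of \<open>i\<close> at \<open>I\<close>, and is
  constant otherwise. If it moves, so do the values at all smaller sets containing \<open>i\<close>,
  by diminishing marginals. Hence the polytope from \<open>A\<close> to \<open>I\<close> is flat and
  its polynomial is 0, unless \<open>I = insert i A\<close>, where it is a point.\<close>

lemma has_real_derivative_vol_poly_truncate:
  fixes z :: "'n::finite set \<Rightarrow> real"
  assumes sub: "submodular z" and AB: "A \<subset> B" and i: "i \<in> B - A" and c2: "2 \<le> card (B - A)"
    and t: "z B - z (B - {i}) < t" "t < z (insert i A) - z A"
    and br: "t \<notin> (\<lambda>I. z I - z (I - {i})) ` UNIV"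
  shows "((\<lambda>t. vol_poly (truncate z i t) A B) has_real_derivative
     vol_poly (truncate z i t) (insert i A) B) (at t)"
proof -
  define \<delta> where "\<delta> I = (if i \<in> I \<and> t < z I - z (I - {i}) then 1 else 0 :: real)" for I
  have "((\<lambda>t. truncate z i t I) has_real_derivative \<delta> I) (at t)" for I
  proof (cases "i \<in> I")
    case True
    have "t \<noteq> z I - z (I - {i})" using br by auto
    then consider "t < z I - z (I - {i})" | "t > z I - z (I - {i})" by linarith
    then show ?thesis
    proof cases
      case 1
      have "((\<lambda>t. z (I - {i}) + t) has_real_derivative 1) (at t)"
        by (auto intro!: derivative_eq_intros)
      then show ?thesis
        by (rule has_field_derivative_transform_within_open[where S = "{..<z I - z (I - {i})}", THEN DERIV_cong])
           (use 1 True in \<open>auto simp: truncate_def \<delta>_def min_def\<close>)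
    next
      case 2
      have "((\<lambda>t. z I) has_real_derivative 0) (at t)" by simp
      then show ?thesis
        by (rule has_field_derivative_transform_within_open[where S = "{z I - z (I - {i})<..}", THEN DERIV_cong])
           (use 2 True in \<open>auto simp: truncate_def \<delta>_def min_def\<close>)
    qed
  qed (simp add: truncate_def \<delta>_def)
  \<comment> \<open>The ends are stationary: \<open>i\<close> is not in \<open>A\<close>, and the
    lower bound on \<open>t\<close> freezes the value at \<open>B\<close>.\<close>
  then have "((\<lambda>t. vol_poly (truncate z i t) A B) has_real_derivative
     (\<Sum>I\<in>{A<..<B}. \<delta> I * vol_poly (truncate z i t) A I * vol_poly (truncate z i t) I B)) (at t)"
    using i t by (intro has_real_derivative_vol_poly) (auto simp: \<delta>_def)
  also have "(\<Sum>I\<in>{A<..<B}. \<delta> I * vol_poly (truncate z i t) A I * vol_poly (truncate z i t) I B) =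
      (\<Sum>I\<in>{insert i A}. \<delta> I * vol_poly (truncate z i t) A I * vol_poly (truncate z i t) I B)"
  proof (rule sum.mono_neutral_right)
    have "B - A \<noteq> {i}" using c2 by auto
    then have "insert i A \<noteq> B" using i by auto
    then show "{insert i A} \<subseteq> {A<..<B}" using i AB by auto
    show "\<forall>I\<in>{A<..<B} - {insert i A}. \<delta> I * vol_poly (truncate z i t) A I * vol_poly (truncate z i t) I B = 0"
    proof
      fix I assume I: "I \<in> {A<..<B} - {insert i A}"
      show "\<delta> I * vol_poly (truncate z i t) A I * vol_poly (truncate z i t) I B = 0"
      proof (cases "i \<in> I \<and> t < z I - z (I - {i})")
        case True
        have "card (I - A) \<noteq> 1"
        proof
          assume "card (I - A) = 1"
          then obtain j where "I - A = {j}" by (auto simp: card_1_singleton_iff)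
          then have "I - A = {i}" using True i by (metis DiffD2 DiffI singletonD)
          then have "I - A = {i}" using True i by (metis DiffD2 DiffI singletonD)
        then have "I = insert i A" using True i I by auto
          then show False using I by simp
        qed
        then have "2 \<le> card (I - A)" using I interval_cards(1)[of I A B] by auto
        then have "vol_poly (truncate z i t) A I = 0"
        proof (rule vol_poly_flat[rotated 2])
          fix J assume J: "A \<subseteq> J" "J \<subseteq> I - {i}"
          then have "t < z (insert i J) - z J"
            using submodular_marginal[OF sub _ J(2)] True by force
          moreover have "insert i J - {i} = J" "i \<notin> J" using J by auto
          ultimately show "truncate z i t (insert i J) = truncate z i t J + t"
            by (simp add: truncate_def)
        qed (use I True i in auto)
        then show ?thesis by simp
      qed (auto simp: \<delta>_def)
    qed
  qed simp
  also have "\<dots> = vol_poly (truncate z i t) (insert i A) B"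
  proof -
    have "insert i A - A = {i}" "insert i A - {i} = A" using i by auto
    then have "\<delta> (insert i A) = 1" "vol_poly (truncate z i t) A (insert i A) = 1"
      using i t by (auto simp: \<delta>_def vol_poly_insert)
    then show ?thesis by simp
  qed
  finally show ?thesis .
qed

text \<open>Coordinate \<open>j\<close> is eliminated by the equation for the coordinate sum.\<close>

definition proj_poly :: "('n::finite set \<Rightarrow> real) \<Rightarrow> 'n set \<Rightarrow> 'n set \<Rightarrow> 'n \<Rightarrow> ('n \<Rightarrow> real) set" where
  "proj_poly z A B j = {x \<in> space (\<Pi>\<^sub>M i\<in>B - A - {j}. lborel).
     \<forall>I\<in>{A..B}. (\<Sum>i\<in>I - A. if i = j then z B - z A - sum x (B - A - {j}) else x i) \<le> z I - z A}"

lemma sets_proj_poly [measurable]: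
  "proj_poly z A B j \<in> sets (\<Pi>\<^sub>M i\<in>B - A - {j}. (lborel :: real measure))"
proof -
  have [measurable]: "(\<lambda>x. if i = j then z B - z A - sum x (B - A - {j}) else x i)
      \<in> borel_measurable (\<Pi>\<^sub>M i\<in>B - A - {j}. (lborel :: real measure))" if "I \<in> {A..B}" "i \<in> I - A" for i I
    using that by (cases "i = j") (auto intro!: borel_measurable_diff borel_measurable_sum measurable_component_singleton[THEN measurable_compose])
  show ?thesis
    unfolding proj_poly_def
    by (intro sets.sets_Collect_finite_All borel_measurable_le borel_measurable_sum) auto
qed

section \<open>Fubini for the projected polytope\<close>

interpretation lborel_product: product_sigma_finite "\<lambda>_ :: 'a. lborel :: real measure"
  by (simp add: product_sigma_finite_def sigma_finite_lborel)

text \<open>On the slice, the remaining coordinates of a set \<open>I\<close> containing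
  \<open>n\<close> are bounded twice, by the inequality for \<open>I\<close> and by that for
  \<open>I - {n}\<close>; this is the minimum in \<open>truncate\<close>. The inequalities for
  \<open>insert n A\<close> and \<open>B - {n}\<close> give the range of \<open>t\<close>.\<close>

lemma proj_poly_slice:
  fixes z :: "'n::finite set \<Rightarrow> real" and t :: real
  assumes AB: "A \<subset> B" and j: "j \<in> B - A" and n: "n \<in> B - A - {j}"
    and y: "y \<in> space (\<Pi>\<^sub>M i\<in>B - insert n A - {j}. lborel)"
  shows "y(n := t) \<in> proj_poly z A B j \<longleftrightarrow>
    t \<in> {z B - z (B - {n})..z (insert n A) - z A} \<and> y \<in> proj_poly (truncate z n t) (insert n A) B j"
proof -
  \<comment> \<open>\<open>c\<close> is the eliminated coordinate \<open>j\<close>, and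
    \<open>g\<close> is the full point on \<open>B - A\<close>.\<close>
  define c where "c = z B - z A - sum (y(n := t)) (B - A - {j})"
  define g where "g i = (if i = j then c else (y(n := t)) i)" for i
  have K: "B - A - {j} = insert n (B - insert n A - {j})" using n by auto
  have c: "c = z B - z A - (t + sum y (B - insert n A - {j}))"
  proof -
    have "sum (y(n := t)) (B - insert n A - {j}) = sum y (B - insert n A - {j})"
      by (rule sum.cong) auto
    then show ?thesis by (simp add: c_def K)
  qed
  have yn: "y(n := t) \<in> space (\<Pi>\<^sub>M i\<in>B - A - {j}. lborel)"
    using y unfolding K by (auto simp: space_PiM PiE_fun_upd)
  have mem: "y(n := t) \<in> proj_poly z A B j \<longleftrightarrow> (\<forall>I\<in>{A..B}. sum g (I - A) \<le> z I - z A)"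
  proof -
    have "(\<lambda>i. if i = j then z B - z A - sum (y(n := t)) (B - A - {j}) else (y(n := t)) i) = g"
      by (simp add: fun_eq_iff g_def c_def)
    then show ?thesis using yn by (simp only: proj_poly_def mem_Collect_eq simp_thms)
  qed
  have gn: "g n = t" using n by (simp add: g_def)
  have total: "sum g (B - A) = z B - z A"
  proof -
    have "B - A = insert j (B - A - {j})" using j by auto
    then have "sum g (B - A) = g j + sum g (B - A - {j})"
      by (metis Diff_iff finite insertI1 sum.insert)
    also have "sum g (B - A - {j}) = sum (y(n := t)) (B - A - {j})"
      by (rule sum.cong) (auto simp: g_def)
    finally show ?thesis by (simp add: g_def c_def)
  qed
  have split: "sum g (I - A) = t + sum g (I - insert n A)" if "n \<in> I" for I
  proof -
    have "I - A = insert n (I - insert n A)" using that n by auto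
    then show ?thesis by (simp add: gn)
  qed
  have slice: "y \<in> proj_poly (truncate z n t) (insert n A) B j \<longleftrightarrow>
      (\<forall>I\<in>{insert n A..B}. t + sum g (I - insert n A) \<le> min (z I) (z (I - {n}) + t) - z A)"
    if t: "t \<in> {z B - z (B - {n})..z (insert n A) - z A}"
  proof -
    have nA: "insert n A - {n} = A" and nB: "n \<in> B" using n by auto
    \<comment> \<open>For \<open>t\<close> in this range the second term attains the minimum at
      \<open>insert n A\<close>, the first at \<open>B\<close>.\<close>
    have zA: "truncate z n t (insert n A) = z A + t" and zB: "truncate z n t B = z B"
      using t nB by (auto simp: truncate_def nA)
    have "(\<Sum>i\<in>I - insert n A. if i = j then truncate z n t B - truncate z n t (insert n A) -
        sum y (B - insert n A - {j}) else y i) = sum g (I - insert n A)" for I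
      unfolding zA zB by (rule sum.cong) (auto simp: g_def c)
    then have "y \<in> proj_poly (truncate z n t) (insert n A) B j \<longleftrightarrow>
        (\<forall>I\<in>{insert n A..B}. sum g (I - insert n A) \<le> truncate z n t I - (z A + t))"
      using y by (simp only: proj_poly_def mem_Collect_eq zA simp_thms)
    also have "\<dots> \<longleftrightarrow> (\<forall>I\<in>{insert n A..B}. t + sum g (I - insert n A) \<le> min (z I) (z (I - {n}) + t) - z A)"
    proof (intro ball_cong refl)
      fix I assume "I \<in> {insert n A..B}"
      then have "truncate z n t I = min (z I) (z (I - {n}) + t)" by (simp add: truncate_def)
      then show "sum g (I - insert n A) \<le> truncate z n t I - (z A + t) \<longleftrightarrow>
          t + sum g (I - insert n A) \<le> min (z I) (z (I - {n}) + t) - z A"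
        by linarith
    qed
    finally show ?thesis .
  qed
  show ?thesis
  proof
    assume "y(n := t) \<in> proj_poly z A B j"
    then have ineq: "sum g (I - A) \<le> z I - z A" if "A \<subseteq> I" "I \<subseteq> B" for I
      using that mem by auto
    have "sum g (insert n A - A) = t"
      using n gn by (simp add: insert_Diff_if)
    then have hi: "t \<le> z (insert n A) - z A" using ineq[of "insert n A"] AB n by auto
    have "B - {n} - A = B - insert n A" by auto
    then have "z B - z A - t \<le> z (B - {n}) - z A"
      using ineq[of "B - {n}"] AB n split[of B] total by auto
    then have t: "t \<in> {z B - z (B - {n})..z (insert n A) - z A}" using hi by simp
    moreover have "t + sum g (I - insert n A) \<le> min (z I) (z (I - {n}) + t) - z A" if I: "I \<in> {insert n A..B}" for I
    proof -
      have "I - {n} - A = I - insert n A" "A \<subseteq> I - {n}" "I - {n} \<subseteq> B" "A \<subseteq> I" "I \<subseteq> B" "n \<in> I"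
        using I n by auto
      then have "sum g (I - insert n A) \<le> z (I - {n}) - z A" "sum g (I - A) \<le> z I - z A"
          "sum g (I - A) = t + sum g (I - insert n A)"
        using ineq[of "I - {n}"] ineq[of I] split[of I] by simp_all
      then show ?thesis by linarith
    qed
    ultimately show "t \<in> {z B - z (B - {n})..z (insert n A) - z A} \<and>
        y \<in> proj_poly (truncate z n t) (insert n A) B j"
      using slice by blast
  next
    assume "t \<in> {z B - z (B - {n})..z (insert n A) - z A} \<and>
        y \<in> proj_poly (truncate z n t) (insert n A) B j"
    then have *: "t + sum g (I - insert n A) \<le> min (z I) (z (I - {n}) + t) - z A"
      if "I \<in> {insert n A..B}" for I
      using that slice by blast
    have "sum g (I - A) \<le> z I - z A" if I: "I \<in> {A..B}" for I
    proof (cases "n \<in> I")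
      case True
      then have "I \<in> {insert n A..B}" using I by simp
      then show ?thesis using *[of I] split[OF True] by simp
    next
      case False
      \<comment> \<open>The inequality for a set without \<open>n\<close> is the second bound at
        \<open>insert n I\<close>.\<close>
      then have "insert n I - insert n A = I - A" "insert n I - {n} = I" "insert n I \<in> {insert n A..B}"
        using I n by auto
      then have "t + sum g (I - A) \<le> min (z (insert n I)) (z I + t) - z A"
        using *[of "insert n I"] by simp
      then show ?thesis by linarith
    qed
    then show "y(n := t) \<in> proj_poly z A B j" using mem by blast
  qed
qed

text \<open>At the upper end of the range the half-space cuts nothing off.\<close>

lemma vol_poly_truncate_hi:
  fixes z :: "'n::finite set \<Rightarrow> real"
  assumes "submodular z" "A \<subset> B" "n \<in> B - A"
  shows "vol_poly (truncate z n (z (insert n A) - z A)) A B = vol_poly z A B"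
proof (rule vol_poly_cong[OF assms(2)])
  fix I assume I: "A \<subseteq> I" "I \<subseteq> B"
  have "z I - z (I - {n}) \<le> z (insert n A) - z A" if "n \<in> I"
    using assms I that by (intro submodular_marginal) auto
  then show "truncate z n (z (insert n A) - z A) I = z I" by (auto simp: truncate_def)
qed

text \<open>At the lower end only a face remains, which is flat.\<close>

lemma vol_poly_truncate_lo:
  fixes z :: "'n::finite set \<Rightarrow> real"
  assumes "submodular z" "A \<subset> B" "n \<in> B - A" "2 \<le> card (B - A)"
  shows "vol_poly (truncate z n (z B - z (B - {n}))) A B = 0"
proof (rule vol_poly_flat[OF assms(2-4)])
  fix J assume J: "A \<subseteq> J" "J \<subseteq> B - {n}"
  then have "z B - z (B - {n}) \<le> z (insert n J) - z J"
    using assms by (intro submodular_marginal) auto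
  moreover have "insert n J - {n} = J" "n \<notin> J" using J by auto
  ultimately show "truncate z n (z B - z (B - {n})) (insert n J) =
      truncate z n (z B - z (B - {n})) J + (z B - z (B - {n}))"
    by (auto simp: truncate_def)
qed

text \<open>The fundamental theorem of calculus, with the finitely many break points as exceptional
  set.\<close>

lemma has_integral_vol_poly_truncate:
  fixes z :: "'n::finite set \<Rightarrow> real"
  assumes sub: "submodular z" and AB: "A \<subset> B" and n: "n \<in> B - A" and c2: "2 \<le> card (B - A)"
  shows "((\<lambda>t. vol_poly (truncate z n t) (insert n A) B) has_integral vol_poly z A B)
    {z B - z (B - {n})..z (insert n A) - z A}"
proof -
  let ?lo = "z B - z (B - {n})" and ?hi = "z (insert n A) - z A"
  have "((\<lambda>t. vol_poly (truncate z n t) (insert n A) B) has_integral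
      vol_poly (truncate z n ?hi) A B - vol_poly (truncate z n ?lo) A B) {?lo..?hi}"
  proof (rule fundamental_theorem_of_calculus_interior_strong)
    show "finite ((\<lambda>I. z I - z (I - {n})) ` UNIV)" by simp
    show "?lo \<le> ?hi" using AB n by (intro submodular_marginal[OF sub]) auto
    show "continuous_on {?lo..?hi} (\<lambda>t. vol_poly (truncate z n t) A B)"
    proof (rule continuous_on_vol_poly)
      show "continuous_on {?lo..?hi} (\<lambda>t. truncate z n t I)" for I
        by (cases "n \<in> I") (auto simp: truncate_def intro!: continuous_intros)
    qed
    show "((\<lambda>t. vol_poly (truncate z n t) A B) has_vector_derivative
       vol_poly (truncate z n t) (insert n A) B) (at t)"
      if "t \<in> {?lo<..<?hi} - (\<lambda>I. z I - z (I - {n})) ` UNIV" for t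
      using has_real_derivative_vol_poly_truncate[OF sub AB n c2, of t] that
      by (simp add: has_real_derivative_iff_has_vector_derivative)
  qed
  then show ?thesis
    using vol_poly_truncate_hi[OF sub AB n] vol_poly_truncate_lo[OF sub AB n c2] by simp
qed

text \<open>Induction on the dimension, slicing by a coordinate \<open>n\<close> other than the
  eliminated \<open>j\<close>. Nonnegativity is carried along because the integrand of a nonnegative
  integral must be recovered from its \<open>ennreal\<close> value.\<close>

lemma emeasure_proj_poly:
  fixes z :: "'n::finite set \<Rightarrow> real"
  assumes "submodular z" "A \<subset> B" "j \<in> B - A"
  shows "0 \<le> vol_poly z A B \<and>
    emeasure (\<Pi>\<^sub>M i\<in>B - A - {j}. lborel) (proj_poly z A B j) = ennreal (vol_poly z A B)"
  using assms
proof (induction "card (B - A)" arbitrary: A z rule: less_induct)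
  case less
  note sub = less.prems(1) and AB = less.prems(2) and j = less.prems(3)
  show ?case
  proof (cases "B - A = {j}")
    case True
    then have B: "B = insert j A" using AB by auto
    have jA: "j \<notin> A" using j by auto
    have "(\<Sum>i\<in>I - A. if i = j then z B - z A - sum x (B - A - {j}) else x i) \<le> z I - z A"
      if "I \<in> {A..B}" for I and x :: "'n \<Rightarrow> real"
    proof -
      have "I = A \<or> I = B" using that B by auto
      then show ?thesis by (elim disjE) (simp_all add: True)
    qed
    then have "proj_poly z A B j = space (\<Pi>\<^sub>M i\<in>B - A - {j}. lborel)"
      unfolding proj_poly_def by blast
    \<comment> \<open>With no coordinate left, the product space is one point of mass 1.\<close>
    then have "emeasure (\<Pi>\<^sub>M i\<in>B - A - {j}. lborel) (proj_poly z A B j) = 1"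
      unfolding True by (simp add: space_PiM_empty)
    moreover have "vol_poly z A B = 1" unfolding B using jA by (rule vol_poly_insert)
    ultimately show ?thesis by simp
  next
    case False
    then obtain n where n: "n \<in> B - A - {j}" using j by auto
    have "card {j, n} \<le> card (B - A)" using n j by (intro card_mono) auto
    then have c2: "2 \<le> card (B - A)" using n by auto
    have IH: "0 \<le> vol_poly (truncate z n t) (insert n A) B \<and>
        emeasure (\<Pi>\<^sub>M i\<in>B - insert n A - {j}. lborel) (proj_poly (truncate z n t) (insert n A) B j) =
          ennreal (vol_poly (truncate z n t) (insert n A) B)" for t
    proof (rule less.hyps)
      show "card (B - insert n A) < card (B - A)" using n by (intro psubset_card_mono) auto
      show "insert n A \<subset> B" "j \<in> B - insert n A" using AB n j by auto
    qed (rule submodular_truncate[OF sub])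
    let ?T = "{z B - z (B - {n})..z (insert n A) - z A}"
    have n': "n \<in> B - A" using n by simp
    note int = has_integral_vol_poly_truncate[OF sub AB n' c2]
    have K: "B - A - {j} = insert n (B - insert n A - {j})" using n by auto
    have "emeasure (\<Pi>\<^sub>M i\<in>B - A - {j}. lborel) (proj_poly z A B j) =
        (\<integral>\<^sup>+x. indicator (proj_poly z A B j) x \<partial>(\<Pi>\<^sub>M i\<in>insert n (B - insert n A - {j}). lborel))"
      using sets_proj_poly[of z A B j] by (simp add: K[symmetric])
    also have "\<dots> = (\<integral>\<^sup>+t. \<integral>\<^sup>+y. indicator (proj_poly z A B j) (y(n := t))
        \<partial>(\<Pi>\<^sub>M i\<in>B - insert n A - {j}. lborel) \<partial>lborel)"
      using sets_proj_poly[of z A B j]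
      by (intro lborel_product.product_nn_integral_insert_rev) (auto simp: K[symmetric])
    also have "\<dots> = (\<integral>\<^sup>+t. ennreal (indicator ?T t * vol_poly (truncate z n t) (insert n A) B) \<partial>lborel)"
    proof (rule nn_integral_cong)
      fix t :: real
      have "(\<integral>\<^sup>+y. indicator (proj_poly z A B j) (y(n := t)) \<partial>(\<Pi>\<^sub>M i\<in>B - insert n A - {j}. lborel)) =
        (\<integral>\<^sup>+y. indicator ?T t * indicator (proj_poly (truncate z n t) (insert n A) B j) y
           \<partial>(\<Pi>\<^sub>M i\<in>B - insert n A - {j}. lborel))"
        using proj_poly_slice[OF AB j n]
        by (intro nn_integral_cong) (auto split: split_indicator)
      also have "\<dots> = indicator ?T t * ennreal (vol_poly (truncate z n t) (insert n A) B)"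
        using IH[of t] sets_proj_poly[of "truncate z n t" "insert n A" B j] by (simp add: nn_integral_cmult)
      finally show "(\<integral>\<^sup>+y. indicator (proj_poly z A B j) (y(n := t)) \<partial>(\<Pi>\<^sub>M i\<in>B - insert n A - {j}. lborel)) =
        ennreal (indicator ?T t * vol_poly (truncate z n t) (insert n A) B)"
        by (simp split: split_indicator)
    qed
    also have "\<dots> = ennreal (vol_poly z A B)"
      using IH int by (intro nn_integral_has_integral_lebesgue) auto
    finally show ?thesis
      using has_integral_nonneg[OF int] IH by auto
  qed
qed

section \<open>From product measure to the prism\<close>

lemma measurable_vec_lambda_PiM [measurable]:
  "(\<lambda>f. \<chi> i. f i) \<in> (\<Pi>\<^sub>M i\<in>(UNIV :: 'n::finite set). (lborel :: real measure)) \<rightarrow>\<^sub>M borel"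
proof -
  have "(\<lambda>f. (\<chi> i. f i) \<bullet> b) \<in> borel_measurable (\<Pi>\<^sub>M i\<in>(UNIV :: 'n set). (lborel :: real measure))"
    if "b \<in> Basis" for b :: "real ^ 'n"
    unfolding inner_vec_def by simp
  then show ?thesis by (subst borel_measurable_euclidean_space) blast
qed

lemma prod_Basis_vec:
  fixes f :: "real ^ 'n::finite \<Rightarrow> 'a::comm_monoid_mult"
  shows "(\<Prod>b\<in>Basis. f b) = (\<Prod>i\<in>UNIV. f (axis i 1))"
proof -
  have "Basis = range (\<lambda>i. axis i 1 :: real ^ 'n)" by (auto simp: Basis_vec_def)
  moreover have "inj (\<lambda>i. axis i 1 :: real ^ 'n)" by (auto simp: inj_on_def axis_eq_axis)
  ultimately show ?thesis by (metis (no_types, lifting) comp_apply prod.cong prod.reindex)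
qed

lemma lborel_vec_eq_distr_PiM:
  "(lborel :: (real ^ 'n::finite) measure) = distr (\<Pi>\<^sub>M i\<in>UNIV. lborel) borel (\<lambda>f. \<chi> i. f i)"
proof (rule lborel_eqI)
  fix l u :: "real ^ 'n"
  assume lu: "\<And>b. b \<in> Basis \<Longrightarrow> l \<bullet> b \<le> u \<bullet> b"
  have le: "l $ i \<le> u $ i" for i
    using lu[of "axis i 1"] by (simp add: inner_axis)
  have "(\<lambda>f. \<chi> i. f i) -` box l u \<inter> space (\<Pi>\<^sub>M i\<in>UNIV. lborel) = (\<Pi>\<^sub>E i\<in>UNIV. {l $ i<..<u $ i})"
    by (auto simp: mem_box_cart space_PiM PiE_iff)
  then have "emeasure (distr (\<Pi>\<^sub>M i\<in>UNIV. lborel) borel (\<lambda>f. \<chi> i. f i)) (box l u) =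
      emeasure (\<Pi>\<^sub>M i\<in>UNIV. lborel) (\<Pi>\<^sub>E i\<in>UNIV. {l $ i<..<u $ i})"
    by (simp add: emeasure_distr)
  also have "\<dots> = (\<Prod>i\<in>UNIV. ennreal (u $ i - l $ i))"
    using le by (subst lborel_product.emeasure_PiM) auto
  also have "\<dots> = ennreal (\<Prod>b\<in>Basis. (u - l) \<bullet> b)"
    using le by (simp add: prod_Basis_vec inner_axis prod_ennreal)
  finally show "emeasure (distr (\<Pi>\<^sub>M i\<in>UNIV. lborel) borel (\<lambda>f. \<chi> i. f i)) (box l u) =
      ennreal (\<Prod>b\<in>Basis. (u - l) \<bullet> b)" .
qed simp

text \<open>Coordinate \<open>j\<close> is integrated first and contributes the length 1 of its
  interval.\<close>

lemma emeasure_cylinder_PiM: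
  fixes Q :: "('n::finite \<Rightarrow> real) set"
  assumes Q: "Q \<in> sets (\<Pi>\<^sub>M i\<in>UNIV - {j}. lborel)"
  defines "C \<equiv> {x :: real ^ 'n. restrict (\<lambda>i. x $ i) (UNIV - {j}) \<in> Q \<and> x $ j \<in> {0..1}}"
  shows "C \<in> sets borel" "emeasure lborel C = emeasure (\<Pi>\<^sub>M i\<in>UNIV - {j}. lborel) Q"
proof -
  let ?K = "UNIV - {j}" and ?M = "\<lambda>K. \<Pi>\<^sub>M i\<in>K. (lborel :: real measure)"
  have UNIV: "UNIV = insert j ?K" by auto
  have "(\<lambda>x :: real ^ 'n. restrict (\<lambda>i. x $ i) ?K) \<in> borel \<rightarrow>\<^sub>M ?M ?K"
    by (rule measurable_restrict) simp
  then have "(\<lambda>x :: real ^ 'n. restrict (\<lambda>i. x $ i) ?K) -` Q \<inter> space borel \<in> sets borel"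
    using Q by (rule measurable_sets)
  moreover have "{x :: real ^ 'n. x $ j \<in> {0..1}} \<in> sets borel" by measurable
  moreover have "C = ((\<lambda>x :: real ^ 'n. restrict (\<lambda>i. x $ i) ?K) -` Q \<inter> space borel) \<inter> {x. x $ j \<in> {0..1}}"
    by (auto simp: C_def)
  ultimately show C: "C \<in> sets borel" by (simp only: sets.Int)
  define C' where "C' = (\<lambda>f. \<chi> i. f i) -` C \<inter> space (?M UNIV)"
  have C': "C' \<in> sets (?M UNIV)"
    unfolding C'_def by (rule measurable_sets[OF measurable_vec_lambda_PiM C])
  have "emeasure lborel C = emeasure (?M UNIV) C'"
    using C by (subst lborel_vec_eq_distr_PiM) (simp add: emeasure_distr C'_def)
  also have "\<dots> = (\<integral>\<^sup>+x. indicator C' x \<partial>?M (insert j ?K))"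
    using C' by (simp add: UNIV[symmetric])
  also have "\<dots> = (\<integral>\<^sup>+x. \<integral>\<^sup>+t. indicator C' (x(j := t)) \<partial>lborel \<partial>?M ?K)"
    using C' by (intro lborel_product.product_nn_integral_insert) (auto simp: UNIV[symmetric])
  also have "\<dots> = (\<integral>\<^sup>+x. indicator Q x \<partial>?M ?K)"
  proof (rule nn_integral_cong)
    fix x assume x: "x \<in> space (?M ?K)"
    have "restrict (($) (vec_lambda (x(j := t)))) ?K = x" for t
      using x by (auto simp: fun_eq_iff restrict_def space_PiM PiE_def extensional_def)
    note restrict = this
    have "x(j := t) \<in> C' \<longleftrightarrow> x \<in> Q \<and> t \<in> {0..1}" for t
      using x by (simp add: C'_def C_def space_PiM restrict)
    then have "(\<integral>\<^sup>+t. indicator C' (x(j := t)) \<partial>lborel) =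
        (\<integral>\<^sup>+t. indicator Q x * indicator {0..1 :: real} t \<partial>lborel)"
      by (intro nn_integral_cong) (auto split: split_indicator)
    also have "\<dots> = indicator Q x" by (simp add: nn_integral_cmult)
    finally show "(\<integral>\<^sup>+t. indicator C' (x(j := t)) \<partial>lborel) = indicator Q x" .
  qed
  finally show "emeasure lborel C = emeasure (?M ?K) Q" using Q by simp
qed

text \<open>
  Taking \<open>j\<close> to be the greatest index makes the shear \<open>G\<close> that restores coordinate \<open>j\<close> lower triangular.
\<close>

lemma prism_gen_permutohedron:
  fixes z :: "'n::{finite,wellorder} set \<Rightarrow> real"
  assumes "z {} = 0" "z UNIV = 0" and j: "\<And>i. i \<le> j"
  defines "C \<equiv> {x :: (real, 'n) vec. restrict (\<lambda>i. x $ i) (UNIV - {j}) \<in> proj_poly z {} UNIV j \<and> x $ j \<in> {0..1}}"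
  obtains F :: "((real, 'n) vec, 'n) vec" where "det F = sqrt (real CARD('n))" "prism (gen_permutohedron z) = (*v) F ` C"
proof -
  let ?K = "UNIV - {j}"
  define G :: "((real, 'n) vec, 'n) vec" where "G = (\<chi> k i. if k = i then 1 else if k = j then - 1 else 0)"
  define m :: "(real, 'n) vec" where "m = (\<chi> k. if k = j then sqrt (real CARD('n)) else 1 / sqrt (real CARD('n)))"
  have "G $ k $ i = 0" if "k < i" for k i
    using that j[of i] by (auto simp: G_def)
  then have detG: "det G = 1" by (subst det_lowerdiagonal) (simp_all add: G_def)
  have Gj: "(G *v x) $ j = x $ j - (\<Sum>i\<in>?K. x $ i)" for x
  proof -
    have "(G *v x) $ j = G $ j $ j * x $ j + (\<Sum>i\<in>?K. G $ j $ i * x $ i)"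
      by (simp add: matrix_vector_mult_def sum.remove[of UNIV j])
    also have "(\<Sum>i\<in>?K. G $ j $ i * x $ i) = (\<Sum>i\<in>?K. - x $ i)"
      by (rule sum.cong) (auto simp: G_def)
    finally show ?thesis by (simp add: G_def sum_negf)
  qed
  have Gk: "(G *v x) $ k = x $ k" if "k \<noteq> j" for x k
  proof -
    have "(G *v x) $ k = (\<Sum>i\<in>UNIV. G $ k $ i * x $ i)"
      by (simp add: matrix_vector_mult_def)
    also have "\<dots> = (\<Sum>i\<in>UNIV. if k = i then x $ i else 0)"
      by (rule sum.cong) (auto simp: G_def that)
    finally show ?thesis by simp
  qed
  have n: "real (card ?K) = real CARD('n) - 1"
    by (simp add: card_Diff_singleton of_nat_diff)
  have Gm: "G *v m = unit_normal"
  proof -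
    have "sqrt (real CARD('n)) - (real CARD('n) - 1) / sqrt (real CARD('n)) = 1 / sqrt (real CARD('n))"
      by (simp add: field_simps)
    moreover have "(\<Sum>i\<in>?K. m $ i) = (real CARD('n) - 1) / sqrt (real CARD('n))"
      using n by (simp add: m_def)
    ultimately have "(G *v m) $ j = 1 / sqrt (real CARD('n))"
      unfolding Gj by (simp add: m_def)
    moreover have "(G *v m) $ k = 1 / sqrt (real CARD('n))" if "k \<noteq> j" for k
      using that unfolding Gk[OF that] by (simp add: m_def)
    ultimately show ?thesis unfolding vec_eq_iff unit_normal_def by (metis vec_lambda_beta)
  qed
  \<comment> \<open>Replacing column \<open>j\<close> of \<open>G\<close> by \<open>G *v m\<close>,
    the unit normal, makes coordinate \<open>j\<close> the height in the prism. By Cramer's rule the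
    determinant is the entry \<open>m $ j\<close> times \<open>det G\<close>.\<close>
  define F where "F = (\<chi> k i. if i = j then (G *v m) $ k else G $ k $ i)"
  have detF: "det F = sqrt (real CARD('n))"
    unfolding F_def cramer_lemma detG by (simp add: m_def)
  \<comment> \<open>\<open>p\<close> restores the coordinate \<open>j\<close> that the vanishing
    coordinate sum forces.\<close>
  define p :: "(real, 'n) vec \<Rightarrow> (real, 'n) vec" where "p x = (\<chi> k. if k = j then - (\<Sum>i\<in>?K. x $ i) else x $ k)" for x
  have Fx: "F *v x = p x + x $ j *\<^sub>R unit_normal" for x
  proof -
    let ?x = "\<chi> i. if i = j then 0 else x $ i"
    have "F *v x = G *v ?x + x $ j *\<^sub>R unit_normal"
      unfolding vec_eq_iff F_def Gm
      by (simp add: matrix_vector_mult_def sum.remove[of UNIV j] mult.commute add.commute)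
    moreover have "(G *v ?x) $ k = p x $ k" for k
      by (cases "k = j") (simp_all add: Gj Gk p_def)
    ultimately show ?thesis by (simp add: vec_eq_iff)
  qed
  have p_sum: "(\<Sum>k\<in>UNIV. p x $ k) = 0" for x
  proof -
    have "(\<Sum>k\<in>UNIV. p x $ k) = p x $ j + (\<Sum>k\<in>?K. p x $ k)" by (rule sum.remove) auto
    also have "(\<Sum>k\<in>?K. p x $ k) = (\<Sum>k\<in>?K. x $ k)" by (rule sum.cong) (auto simp: p_def)
    finally show ?thesis by (simp add: p_def)
  qed
  have p_mem: "p x \<in> gen_permutohedron z \<longleftrightarrow> restrict (\<lambda>i. x $ i) ?K \<in> proj_poly z {} UNIV j" for x
  proof -
    have "(\<Sum>i\<in>I. if i = j then z UNIV - z {} - sum (restrict (\<lambda>i. x $ i) ?K) (UNIV - {} - {j})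
        else restrict (\<lambda>i. x $ i) ?K i) = (\<Sum>i\<in>I. p x $ i)" for I
      by (rule sum.cong) (auto simp: p_def assms(1,2))
    moreover have "{{}..UNIV} = (UNIV :: 'n set set)" by auto
    ultimately show ?thesis
      by (simp add: gen_permutohedron_def proj_poly_def p_sum assms(1,2) space_PiM)
  qed
  have "prism (gen_permutohedron z) = (*v) F ` C"
  proof (intro equalityI subsetI)
    fix y assume "y \<in> prism (gen_permutohedron z)"
    then obtain x s where y: "y = x + s *\<^sub>R unit_normal" and x: "x \<in> gen_permutohedron z" and s: "0 \<le> s" "s \<le> 1"
      unfolding prism_def by blast
    define v where "v = (\<chi> k. if k = j then s else x $ k)"
    have "(\<Sum>k\<in>UNIV. x $ k) = 0" using x assms(2) by (simp add: gen_permutohedron_def)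
    then have "x $ j + (\<Sum>k\<in>?K. x $ k) = 0" by (simp add: sum.remove[of UNIV j])
    moreover have "(\<Sum>k\<in>?K. v $ k) = (\<Sum>k\<in>?K. x $ k)" by (rule sum.cong) (auto simp: v_def)
    ultimately have "p v = x" by (auto simp: vec_eq_iff p_def v_def)
    moreover have vj: "v $ j = s" by (simp add: v_def)
    ultimately have "y = F *v v" by (simp add: y Fx)
    moreover have "restrict (\<lambda>i. v $ i) ?K \<in> proj_poly z {} UNIV j"
      using p_mem[of v] x \<open>p v = x\<close> by simp
    then have "v \<in> C" using s vj by (simp add: C_def)
    ultimately show "y \<in> (*v) F ` C" by blast
  next
    fix y assume "y \<in> (*v) F ` C"
    then obtain v where "v \<in> C" "y = p v + v $ j *\<^sub>R unit_normal" using Fx by auto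
    then show "y \<in> prism (gen_permutohedron z)"
      unfolding prism_def C_def using p_mem by auto
  qed
  with detF show ?thesis by (rule that)
qed

text \<open>The factor \<open>sqrt (real CARD('n))\<close> of the shear cancels the Euclidean volume
  of a lattice parallelepiped.\<close>

lemma Vol_gen_permutohedron:
  fixes z :: "'n::{finite,wellorder} set \<Rightarrow> real"
  assumes "submodular z" "z {} = 0" "z UNIV = 0"
  shows "Vol (gen_permutohedron z) = vol_poly z {} UNIV"
proof -
  define j where "j = Max (UNIV :: 'n set)"
  have j: "i \<le> j" for i by (simp add: j_def)
  let ?Q = "proj_poly z {} UNIV j"
  define C where "C = {x :: (real, 'n) vec. restrict (\<lambda>i. x $ i) (UNIV - {j}) \<in> ?Q \<and> x $ j \<in> {0..1}}"
  obtain F :: "((real, 'n) vec, 'n) vec" where F: "det F = sqrt (real CARD('n))" "prism (gen_permutohedron z) = (*v) F ` C"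
    using prism_gen_permutohedron[OF assms(2,3) j] unfolding C_def by blast
  have Q: "?Q \<in> sets (\<Pi>\<^sub>M i\<in>UNIV - {j}. lborel)"
    using sets_proj_poly[of z "{}" UNIV j] by simp
  note CQ = emeasure_cylinder_PiM[OF Q, folded C_def]
  have vol: "0 \<le> vol_poly z {} UNIV" "emeasure lborel C = ennreal (vol_poly z {} UNIV)"
    using emeasure_proj_poly[OF assms(1), of "{}" UNIV j] CQ(2) by (auto simp: psubset_eq)
  then have "C \<in> lmeasurable" using CQ(1) by (intro fmeasurableI) auto
  then have "euclidean_vol (gen_permutohedron z) = sqrt (real CARD('n)) * measure lebesgue C"
    unfolding euclidean_vol_def F(2) by (simp add: measure_linear_image F(1))
  also have "measure lebesgue C = vol_poly z {} UNIV"
    using vol CQ(1) by (simp add: measure_def)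
  finally show ?thesis by (simp add: Vol_eq)
qed

section \<open>Unfolding the recursion over chains\<close>

text \<open>A variable top set and a variable total degree keep the family closed under removal of
  the last set of a chain.\<close>

definition chain_lists :: "'n::finite set \<Rightarrow> nat \<Rightarrow> ('n set list \<times> nat list) set" where
  "chain_lists J D = {(Is, ds). length Is = length ds \<and> sorted_wrt (\<subset>) ({} # Is @ [J]) \<and>
     (\<forall>e\<in>set ds. 0 < e) \<and> sum_list ds = D}"

definition chain_weight :: "('n::finite set \<Rightarrow> real) \<Rightarrow> 'n set \<Rightarrow> 'n set list \<Rightarrow> nat list \<Rightarrow> real" where
  "chain_weight z J Is ds = (\<Prod>i<length Is.
     int_binomial (int (ds ! i) - 1) (int (partial_sum ds i) - int (card (Is ! i))) *
     int_binomial (int (card ((Is @ [J]) ! Suc i)) - int (card (Is ! i)) - 1)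
       (int (partial_sum ds i) - int (card (Is ! i))) *
     dpow (ds ! i) (z (Is ! i)))"

lemma length_le_sum_list_pos:
  "\<forall>e\<in>set ds. 0 < e \<Longrightarrow> length ds \<le> sum_list (ds :: nat list)"
  by (induction ds) auto

lemma finite_chain_lists: "finite (chain_lists (J :: 'n::finite set) D)"
proof (rule finite_subset)
  show "chain_lists J D \<subseteq> {Is. set Is \<subseteq> UNIV \<and> length Is \<le> D} \<times> {ds. set ds \<subseteq> {..D} \<and> length ds \<le> D}"
  proof clarify
    fix Is :: "'n set list" and ds assume "(Is, ds) \<in> chain_lists J D"
    then have "length Is = length ds" "\<forall>e\<in>set ds. 0 < e" "sum_list ds = D"
      by (auto simp: chain_lists_def)
    then show "Is \<in> {Is. set Is \<subseteq> UNIV \<and> length Is \<le> D} \<and> ds \<in> {ds. set ds \<subseteq> {..D} \<and> length ds \<le> D}"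
      using length_le_sum_list_pos[of ds] member_le_sum_list[of _ ds] by auto
  qed
qed (intro finite_cartesian_product finite_lists_length_le; simp)

lemma chain_lists_snoc:
  "(Is @ [H], ds @ [e]) \<in> chain_lists J D \<longleftrightarrow>
     H \<in> {{}<..<J} \<and> e \<in> {1..D} \<and> (Is, ds) \<in> chain_lists H (D - e)"
proof -
  have "sorted_wrt (\<subset>) (L @ [H, J]) \<longleftrightarrow> sorted_wrt (\<subset>) (L @ [H]) \<and> H \<subset> J" for L
    by (simp add: sorted_wrt_append) (meson psubset_trans)
  from this[of "{} # Is"] have "sorted_wrt (\<subset>) ({} # (Is @ [H]) @ [J]) \<longleftrightarrow>
      sorted_wrt (\<subset>) ({} # Is @ [H]) \<and> {} \<subset> H \<and> H \<subset> J"
    by simp blast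
  moreover have "(sum_list (ds @ [e]) = D \<and> 0 < e) \<longleftrightarrow> (e \<in> {1..D} \<and> sum_list ds = D - e)"
    by auto
  ultimately show ?thesis
    unfolding chain_lists_def mem_Collect_eq case_prod_conv length_append set_append greaterThanLessThan_iff
    by simp blast
qed

lemma chain_lists_Nil: "([], ds) \<in> chain_lists J D \<longleftrightarrow> ds = [] \<and> J \<noteq> {} \<and> D = 0"
  by (auto simp: chain_lists_def)

lemma sum_chain_lists:
  fixes f :: "'n::finite set list \<Rightarrow> nat list \<Rightarrow> real"
  assumes "J \<noteq> {}"
  shows "(\<Sum>(Is, ds)\<in>chain_lists J D. f Is ds) = (if D = 0 then f [] [] else 0) +
    (\<Sum>H\<in>{{}<..<J}. \<Sum>e=1..D. \<Sum>(Is, ds)\<in>chain_lists H (D - e). f (Is @ [H]) (ds @ [e]))"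
proof -
  let ?N = "{p \<in> chain_lists J D. fst p = []}" and ?S = "{p \<in> chain_lists J D. fst p \<noteq> []}"
  have "(\<Sum>(Is, ds)\<in>chain_lists J D. f Is ds) =
      (\<Sum>(Is, ds)\<in>?N. f Is ds) + (\<Sum>(Is, ds)\<in>?S. f Is ds)"
    by (subst sum.union_disjoint[symmetric]) (auto simp: finite_chain_lists intro!: sum.cong)
  also have "?N = (if D = 0 then {([], [])} else {})"
    using assms by (auto simp: chain_lists_Nil)
  also have "(\<Sum>(Is, ds)\<in>?S. f Is ds) = (\<Sum>q\<in>(SIGMA p:{{}<..<J} \<times> {1..D}. chain_lists (fst p) (D - snd p)).
      case q of ((H, e), (Is, ds)) \<Rightarrow> f (Is @ [H]) (ds @ [e]))"
  proof (rule sum.reindex_bij_witness[of _ "\<lambda>((H, e), (Is, ds)). (Is @ [H], ds @ [e])"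
        "\<lambda>(Is, ds). ((last Is, last ds), (butlast Is, butlast ds))"], goal_cases)
    case (1 p)
    obtain Is ds where p: "p = (Is, ds)" by force
    have "Is \<noteq> []" "ds \<noteq> []" using 1 unfolding p by (auto simp: chain_lists_def)
    then show ?case by (simp add: p)
  next
    case (2 p)
    obtain Is ds where p: "p = (Is, ds)" by force
    have "Is \<noteq> []" "ds \<noteq> []" using 2 unfolding p by (auto simp: chain_lists_def)
    then have "butlast Is @ [last Is] = Is" "butlast ds @ [last ds] = ds" by simp_all
    then show ?case
      using 2 chain_lists_snoc[of "butlast Is" "last Is" "butlast ds" "last ds" J D] by (simp add: p)
  next
    case (3 q)
    then obtain H e Is ds where "q = ((H, e), (Is, ds))" by (metis surj_pair)
    then show ?case by simp
  next
    case (4 q)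
    moreover obtain H e Is ds where "q = ((H, e), (Is, ds))" by (metis surj_pair)
    ultimately show ?case by (simp add: chain_lists_snoc)
  next
    case (5 p)
    obtain Is ds where p: "p = (Is, ds)" by force
    have "Is \<noteq> []" "ds \<noteq> []" using 5 unfolding p by (auto simp: chain_lists_def)
    then show ?case by (simp add: p)
  qed
  also have "\<dots> = (\<Sum>p\<in>{{}<..<J} \<times> {1..D}. \<Sum>(Is, ds)\<in>chain_lists (fst p) (D - snd p).
      f (Is @ [fst p]) (ds @ [snd p]))"
    by (subst sum.Sigma) (simp_all add: finite_chain_lists case_prod_beta)
  also have "\<dots> = (\<Sum>H\<in>{{}<..<J}. \<Sum>e=1..D. \<Sum>(Is, ds)\<in>chain_lists H (D - e). f (Is @ [H]) (ds @ [e]))"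
    by (subst sum.cartesian_product) (simp add: case_prod_beta)
  finally show ?thesis by simp
qed

text \<open>Each factor sees only the next set and the exponents up to its own, so the earlier
  factors are those of a chain with top \<open>H\<close>.\<close>

lemma chain_weight_snoc:
  assumes "length Is = length ds"
  shows "chain_weight z J (Is @ [H]) (ds @ [e]) = chain_weight z H Is ds *
    (int_binomial (int e - 1) (int (sum_list ds + e) - int (card H)) *
     int_binomial (int (card J) - int (card H) - 1) (int (sum_list ds + e) - int (card H)) *
     dpow e (z H))"
proof -
  have nth: "((Is @ [H]) @ [J]) ! Suc i = (Is @ [H]) ! Suc i" "(Is @ [H]) ! i = Is ! i"
    "(ds @ [e]) ! i = ds ! i" "partial_sum (ds @ [e]) i = partial_sum ds i" if "i \<in> {..<length Is}" for i
    using that assms by (auto simp: nth_append partial_sum_def)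
  have last: "((Is @ [H]) @ [J]) ! Suc (length Is) = J" "(Is @ [H]) ! length Is = H"
    "(ds @ [e]) ! length Is = e" "partial_sum (ds @ [e]) (length Is) = sum_list ds + e"
    using nth_append_length[of "Is @ [H]" J "[]"] assms by (simp_all add: partial_sum_def nth_append)
  have "length (Is @ [H]) = Suc (length Is)" by simp
  then show ?thesis
    unfolding chain_weight_def
    by (simp only: prod.lessThan_Suc last) (simp only: nth cong: prod.cong)
qed

text \<open>The gap below \<open>B\<close> has at most \<open>card (B - A)\<close> elements, so its
  binomial coefficient in \<open>b\<close> vanishes.\<close>

lemma chain_sum_eq_0:
  fixes A B :: "'n::finite set"
  assumes "A \<subset> B" "card (B - A) \<le> b"
  shows "chain_sum z A B b = 0"
proof -
  have "card (B - H) - 1 < b" if "H = A \<or> H \<in> {A<..<B}" for H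
  proof -
    have "A \<subseteq> H" "H \<subset> B" using that assms(1) by auto
    then have "card (B - H) \<le> card (B - A)" "card (B - H) > 0"
      by (auto intro!: card_mono simp: card_gt_0_iff)
    then show ?thesis using assms by simp
  qed
  moreover have "kern m b x = 0" "kern_int m b b' x = 0" if "m - 1 < b" for m b' x
    using that by (simp_all add: kern_def kern_int_def binomial_eq_0)
  ultimately show ?thesis
    using assms(1) by (subst chain_sum.simps) simp
qed

lemma int_binomial_nat: "int_binomial (int a) (int b) = real (a choose b)"
  by (simp add: int_binomial_def)

text \<open>
  With \<open>c = D - h\<close>, the exponent \<open>e\<close> is \<open>Suc (b' + c)\<close>; the exponents \<open>e \<le> c\<close> and the
  case \<open>D < h\<close> drop out because a binomial coefficient vanishes.
\<close>

lemma sum_kern_int_eq: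
  assumes "0 < h" "h \<le> N" "0 < m" "b + D + 1 = h + m"
    and L: "\<And>b'. b' < h \<Longrightarrow> L b' = T (h - 1 - b')" "\<And>b'. h \<le> b' \<Longrightarrow> L b' = 0"
  shows "(\<Sum>b'<N. kern_int m b b' x * L b') = (-1) ^ (m - 1) *
    (\<Sum>e=1..D. int_binomial (int e - 1) (int D - int h) * int_binomial (int m - 1) (int D - int h) *
       dpow e x * T (D - e))"
proof (cases "D < h")
  case True
  then have "m - 1 < b" using assms(3,4) by linarith
  then have "kern_int m b b' x = 0" for b' by (simp add: kern_int_def binomial_eq_0)
  moreover have "int_binomial a (int D - int h) = 0" for a
    using True by (simp add: int_binomial_def)
  ultimately show ?thesis by simp
next
  case False
  define c where "c = D - h"
  have D: "D = c + h" and bc: "m - 1 - b = c" "b \<le> m - 1" using False assms by (auto simp: c_def)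
  have mb: "real ((m - 1) choose b) = real ((m - 1) choose c)"
    using bc by (metis binomial_symmetric)
  have "(\<Sum>b'<N. kern_int m b b' x * L b') = (\<Sum>b'<h. kern_int m b b' x * L b')"
    using assms by (intro sum.mono_neutral_right) auto
  also have "\<dots> = (\<Sum>b'<h. (-1) ^ (m - 1) * (real ((b' + c) choose c) * real ((m - 1) choose c) *
      dpow (Suc (b' + c)) x * T (h - 1 - b')))"
  proof (rule sum.cong[OF refl])
    fix b' assume "b' \<in> {..<h}"
    then have "L b' = T (h - 1 - b')" using L by simp
    moreover have "real ((b' + c) choose c) = fact (b' + c) / (fact b' * fact c)"
      by (simp add: binomial_fact)
    ultimately show "kern_int m b b' x * L b' = (-1) ^ (m - 1) * (real ((b' + c) choose c) * real ((m - 1) choose c) *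
      dpow (Suc (b' + c)) x * T (h - 1 - b'))"
      by (simp add: kern_int_def bc[simplified] mb[simplified] dpow_def del: of_nat_Suc of_nat_add) (simp add: mult_ac)
  qed
  also have "\<dots> = (\<Sum>e=Suc c..D. (-1) ^ (m - 1) * (real ((e - 1) choose c) * real ((m - 1) choose c) *
      dpow e x * T (D - e)))"
    by (rule sum.reindex_bij_witness[of _ "\<lambda>e. e - Suc c" "\<lambda>b'. Suc (b' + c)"]) (auto simp: D)
  also have "\<dots> = (\<Sum>e=1..D. (-1) ^ (m - 1) * (real ((e - 1) choose c) * real ((m - 1) choose c) *
      dpow e x * T (D - e)))"
    by (intro sum.mono_neutral_left) auto
  also have "\<dots> = (\<Sum>e=1..D. (-1) ^ (m - 1) * (int_binomial (int e - 1) (int D - int h) *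
      int_binomial (int m - 1) (int D - int h) * dpow e x * T (D - e)))"
  proof (rule sum.cong[OF refl])
    fix e assume "e \<in> {1..D}"
    then have "int e - 1 = int (e - 1)" "int m - 1 = int (m - 1)" "int D - int h = int c"
      using \<open>0 < m\<close> by (auto simp: D)
    then show "(-1) ^ (m - 1) * (real ((e - 1) choose c) * real ((m - 1) choose c) *
      dpow e x * T (D - e)) = (-1) ^ (m - 1) * (int_binomial (int e - 1) (int D - int h) *
      int_binomial (int m - 1) (int D - int h) * dpow e x * T (D - e))"
      by (simp only: int_binomial_nat)
  qed
  finally show ?thesis by (simp add: sum_distrib_left)
qed

text \<open>By homogeneity, the degree \<open>card J - 1\<close> is shared between the
  \<open>b\<close> factors at the top and the \<open>D\<close> factors in the chain. Each gap
  \<open>m\<close> carries the sign \<open>(-1) ^ (m - 1)\<close>; as there is one gap more than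
  there are intermediate sets, these multiply to the stated sign.\<close>

lemma chain_sum_eq_sum_chain_lists:
  fixes z :: "'n::finite set \<Rightarrow> real"
  assumes "z {} = 0" "b + D + 1 = card J"
  shows "chain_sum z {} J b =
    (\<Sum>(Is, ds)\<in>chain_lists J D. (-1) ^ (card J + 1 + length Is) * chain_weight z J Is ds)"
  using finite[of J] assms(2)
proof (induction J arbitrary: b D rule: finite_psubset_induct)
  case (psubset J)
  have "J \<noteq> {}" using psubset.prems by auto
  \<comment> \<open>The bottom value is 0, so the empty chain contributes only in degree 0.\<close>
  have kern0: "kern (card J) b 0 = (if D = 0 then (-1) ^ (card J + 1) else 0)"
    using psubset.prems by (cases "card J") (auto simp: kern_def dpow_at_0)
  have "(\<Sum>b'<CARD('n). kern_int (card (J - H)) b b' (z H) * chain_sum z {} H b') =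
      (\<Sum>e=1..D. \<Sum>(Is, ds)\<in>chain_lists H (D - e).
        (-1) ^ (card J + 1 + length (Is @ [H])) * chain_weight z J (Is @ [H]) (ds @ [e]))"
    if H: "H \<in> {{}<..<J}" for H
  proof -
    let ?T = "\<lambda>D. \<Sum>(Is, ds)\<in>chain_lists H D. (-1) ^ (card H + 1 + length Is) * chain_weight z H Is ds"
    have cards: "card J = card H + card (J - H)" "0 < card H" "0 < card (J - H)" "card H \<le> CARD('n)"
      using H interval_cards[OF H] by (auto intro: card_mono)
    have "(\<Sum>b'<CARD('n). kern_int (card (J - H)) b b' (z H) * chain_sum z {} H b') = (-1) ^ (card (J - H) - 1) *
      (\<Sum>e=1..D. int_binomial (int e - 1) (int D - int (card H)) *
        int_binomial (int (card (J - H)) - 1) (int D - int (card H)) * dpow e (z H) * ?T (D - e))"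
    proof (rule sum_kern_int_eq)
      show "b + D + 1 = card H + card (J - H)" using cards psubset.prems by simp
      show "chain_sum z {} H b' = ?T (card H - 1 - b')" if "b' < card H" for b'
        using H that by (intro psubset.IH) auto
      show "chain_sum z {} H b' = 0" if "card H \<le> b'" for b'
        using H that by (intro chain_sum_eq_0) auto
    qed (use cards in auto)
    also have "\<dots> = (\<Sum>e=1..D. \<Sum>(Is, ds)\<in>chain_lists H (D - e).
        (-1) ^ (card J + 1 + length (Is @ [H])) * chain_weight z J (Is @ [H]) (ds @ [e]))"
      unfolding sum_distrib_left
    proof (intro sum.cong refl)
      fix e and p :: "'n set list \<times> nat list"
      assume e: "e \<in> {1..D}" and "p \<in> chain_lists H (D - e)"
      then obtain Is ds where p: "p = (Is, ds)" and mem: "(Is, ds) \<in> chain_lists H (D - e)"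
        by (cases p) auto
      have len: "length Is = length ds" and D: "sum_list ds + e = D"
        using e mem by (auto simp: chain_lists_def)
      have sign: "(-1 :: real) ^ (card J + 1 + length (Is @ [H])) =
          (-1) ^ (card (J - H) - 1) * (-1) ^ (card H + 1 + length Is)"
        using cards by (cases "card (J - H)") (simp_all add: power_add)
      have int: "int (card (J - H)) - 1 = int (card J) - int (card H) - 1" using cards by simp
      show "(-1) ^ (card (J - H) - 1) *
          (int_binomial (int e - 1) (int D - int (card H)) *
           int_binomial (int (card (J - H)) - 1) (int D - int (card H)) * dpow e (z H) *
           (case p of (Is, ds) \<Rightarrow> (-1) ^ (card H + 1 + length Is) * chain_weight z H Is ds)) =
         (case p of (Is, ds) \<Rightarrow>
           (-1) ^ (card J + 1 + length (Is @ [H])) * chain_weight z J (Is @ [H]) (ds @ [e]))"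
        unfolding p case_prod_conv chain_weight_snoc[OF len] D int sign by (simp only: mult_ac)
    qed
    finally show ?thesis .
  qed
  then have "chain_sum z {} J b = kern (card J) b 0 +
      (\<Sum>H\<in>{{}<..<J}. \<Sum>e=1..D. \<Sum>(Is, ds)\<in>chain_lists H (D - e).
        (-1) ^ (card J + 1 + length (Is @ [H])) * chain_weight z J (Is @ [H]) (ds @ [e]))"
    by (subst chain_sum.simps) (simp add: assms(1))
  also have "kern (card J) b 0 = (if D = 0 then (-1) ^ (card J + 1 + length ([] :: 'n set list)) * chain_weight z J [] [] else 0)"
    by (simp add: kern0 chain_weight_def)
  finally show ?case unfolding sum_chain_lists[OF \<open>J \<noteq> {}\<close>] .
qed

lemma prod_list_fact_eq: "(\<Prod>e\<leftarrow>ds. fact e :: real) = (\<Prod>i<length ds. fact (ds ! i))"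
  by (induction ds rule: rev_induct) (auto simp: nth_append)

lemma chain_tuples_sum_eq:
  fixes z :: "'n::finite set \<Rightarrow> real"
  assumes "z {} = 0" "z UNIV = 0"
  shows "(\<Sum>(Is, ds)\<in>chain_tuples.
       (-1) ^ ((CARD('n) - 1) - length Is) * multinomial (CARD('n) - 1) ds *
       (\<Prod>i<length Is.
          int_binomial (int (ds ! i) - 1) (int (partial_sum ds i) - int (card (Is ! i))) *
          int_binomial (int (card ((Is @ [UNIV]) ! Suc i)) - int (card (Is ! i)) - 1)
                       (int (partial_sum ds i) - int (card (Is ! i))) *
          z (Is ! i) ^ (ds ! i))) = fact (CARD('n) - 1) * vol_poly z {} UNIV"
proof -
  have n: "0 < CARD('n)" by simp
  \<comment> \<open>The top value is 0, which leaves only \<open>b = 0\<close>.\<close>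
  have "vol_poly z {} UNIV = (\<Sum>b<CARD('n). if b = 0 then chain_sum z {} UNIV 0 else 0)"
    unfolding vol_poly_def by (rule sum.cong) (auto simp: assms dpow_at_0)
  also have "\<dots> = chain_sum z {} UNIV 0" using n by (subst sum.delta) auto
  also have "\<dots> = (\<Sum>(Is, ds)\<in>chain_tuples. (-1) ^ (CARD('n) + 1 + length Is) * chain_weight z UNIV Is ds)"
    using chain_sum_eq_sum_chain_lists[where b = 0 and D = "CARD('n) - 1" and J = "UNIV :: 'n set" and z = z, OF assms(1)] n
    by (simp add: chain_lists_def chain_tuples_def)
  finally have vol: "vol_poly z {} UNIV =
    (\<Sum>(Is, ds)\<in>chain_tuples. (-1) ^ (CARD('n) + 1 + length Is) * chain_weight z UNIV Is ds)" .
  show ?thesis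
    unfolding vol sum_distrib_left
  proof (rule sum.cong[OF refl])
    fix p :: "'n set list \<times> nat list" assume "p \<in> chain_tuples"
    then obtain Is ds where p: "p = (Is, ds)" and len: "length Is = length ds"
      and pos: "\<forall>e\<in>set ds. 0 < e" and sum: "sum_list ds = CARD('n) - 1"
      by (auto simp: chain_tuples_def)
    let ?P = "\<Prod>i<length Is.
          int_binomial (int (ds ! i) - 1) (int (partial_sum ds i) - int (card (Is ! i))) *
          int_binomial (int (card ((Is @ [UNIV]) ! Suc i)) - int (card (Is ! i)) - 1)
                       (int (partial_sum ds i) - int (card (Is ! i))) *
          z (Is ! i) ^ (ds ! i)"
    \<comment> \<open>Positive exponents bound the length of the chain, so the subtraction in the
      exponent of the sign does not truncate.\<close>
    have "length Is \<le> CARD('n) - 1" using length_le_sum_list_pos[OF pos] len sum by simp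
    moreover obtain N where N: "CARD('n) = Suc N" using n gr0_implies_Suc by blast
    ultimately have "CARD('n) + 1 + length Is = (CARD('n) - 1 - length Is) + 2 * (length Is + 1)"
      unfolding N by simp
    then have sign: "(-1 :: real) ^ (CARD('n) + 1 + length Is) = (-1) ^ (CARD('n) - 1 - length Is)"
      by (simp only: power_add power_mult) simp
    \<comment> \<open>The factorials of the divided powers form the denominator of the multinomial
      coefficient.\<close>
    have weight: "chain_weight z UNIV Is ds = ?P / (\<Prod>e\<leftarrow>ds. fact e)"
      by (simp add: chain_weight_def dpow_def prod_list_fact_eq len prod_dividef)
    show "(case p of (Is, ds) \<Rightarrow>
        (-1) ^ ((CARD('n) - 1) - length Is) * multinomial (CARD('n) - 1) ds *
       (\<Prod>i<length Is.
          int_binomial (int (ds ! i) - 1) (int (partial_sum ds i) - int (card (Is ! i))) *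
          int_binomial (int (card ((Is @ [UNIV]) ! Suc i)) - int (card (Is ! i)) - 1)
                       (int (partial_sum ds i) - int (card (Is ! i))) *
          z (Is ! i) ^ (ds ! i))) =
       fact (CARD('n) - 1) * (case p of (Is, ds) \<Rightarrow> (-1) ^ (CARD('n) + 1 + length Is) * chain_weight z UNIV Is ds)"
      unfolding p multinomial_def case_prod_conv sign weight by simp
  qed
qed

theorem proposition4p2:
  fixes z :: "'n::{finite,wellorder} set \<Rightarrow> real"
  assumes "submodular z" and "z {} = 0" and "z UNIV = 0"
  shows "fact (CARD('n) - 1) * Vol (gen_permutohedron z) =
    (\<Sum>(Is, ds)\<in>chain_tuples.
       (-1) ^ ((CARD('n) - 1) - length Is) * multinomial (CARD('n) - 1) ds *
       (\<Prod>i<length Is.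
          int_binomial (int (ds ! i) - 1) (int (partial_sum ds i) - int (card (Is ! i))) *
          int_binomial (int (card ((Is @ [UNIV]) ! Suc i)) - int (card (Is ! i)) - 1)
                       (int (partial_sum ds i) - int (card (Is ! i))) *
          z (Is ! i) ^ (ds ! i)))"
proof -
  have "Vol (gen_permutohedron z) = vol_poly z {} UNIV"
    using assms by (rule Vol_gen_permutohedron)
  then show ?thesis
    using chain_tuples_sum_eq[OF assms(2,3)] by simp
qed

end
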